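(* Let $n\ge1$, $r\ge1$ be integers, let $\chi$ be a multiplicative character of $\mathbb{Z}_n^*$ with conductor $f$, and let $\lambda(x)=\exp\left(\frac{2\pi\sqrt{-1}\,ax}{n}\right)$ for some $a\in\mathbb{Z}$, with $d=\gcd(a,n)$ (so $\lambda$ has order $n/d$). If $f\mid n/d$, then $$G(\mathrm{GL}_r(\mathbb{Z}_n),\chi,\lambda)=n^{\frac{r(r-1)}{2}}d^{\frac{r(r+1)}{2}}\prod_{\substack{p\mid n\\ p\nmid n/d}}\prod_{i=1}^r(1-p^{-i})\;G(\mathbb{Z}_{n/d},\chi',\lambda)^r,$$ where the outer product is over primes $p$. If $f\nmid n/d$, then $G(\mathrm{GL}_r(\mathbb{Z}_n),\chi,\lambda)=0$.
   Context: $\mathbb{Z}_n=\mathbb{Z}/n\mathbb{Z}$, $\mathbb{Z}_n^*$ its unit group, $\mathrm{GL}_r(\mathbb{Z}_n)$ the invertible $r\times r$ matrices over $\mathbb{Z}_n$. For a ring $\mathbb{Z}_m$, a multiplicative character $\psi$ of $\mathbb{Z}_m^*$ and an additive character $\mu$ of $\mathbb{Z}_m$, $G(\mathbb{Z}_m,\psi,\mu)=\sum_{x\in\mathbb{Z}_m^*}\psi(x)\mu(x)$; and $G(\mathrm{GL}_r(\mathbb{Z}_n),\chi,\lambda)=\sum_{X\in\mathrm{GL}_r(\mathbb{Z}_n)}\chi(\det X)\lambda(\mathrm{tr}\,X)$. The conductor $f$ of $\chi$ is the smallest positive integer $f$ such that $\chi$ factors through $\mathbb{Z}_f^*$ (i.e.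 $\chi(c)=1$ for all units $c$ with $c\equiv1\pmod f$). When $f\mid n/d$, $\chi'$ is the character of $\mathbb{Z}_{n/d}^*$ given by $\chi'(c \bmod n/d)=\chi(c\bmod n)$ for $\gcd(c,n)=1$, and $\lambda$ is regarded as a character of $\mathbb{Z}_{n/d}$ via $\lambda(x\bmod n/d)=\exp\left(\frac{2\pi\sqrt{-1}(a/d)x}{n/d}\right)$, which is well defined. *)

theory Defs
  imports
    Complex_Main
    "HOL-Number_Theory.Cong"
    "HOL-Computational_Algebra.Primes"
    "Jordan_Normal_Form.Determinant"
begin

text \<open>
  The ring of integers modulo \<open>n\<close> is represented by the least nonnegative residues; sums,
  products, determinants and traces are computed over the integers and then reduced modulo \<open>n\<close>.
  The locale \<open>residues\<close> is not used because it excludes \<open>n = 1\<close>. For \<open>n = 1\<close> the definitions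
  below yield the zero ring, whose only element \<open>0\<close> is a unit.
\<close>

definition Zmod :: "nat \<Rightarrow> int set" where
  "Zmod n = {0..<int n}"

definition Zmod_units :: "nat \<Rightarrow> int set" where
  "Zmod_units n = {x \<in> Zmod n. \<exists>y \<in> Zmod n. [x * y = 1] (mod int n)}"

definition mat_mod :: "nat \<Rightarrow> int mat \<Rightarrow> int mat" where
  "mat_mod n = map_mat (\<lambda>x. x mod int n)"

definition GL_Zmod :: "nat \<Rightarrow> nat \<Rightarrow> int mat set" where
  "GL_Zmod r n =
     {X \<in> carrier_mat r r. elements_mat X \<subseteq> Zmod n \<and>
        (\<exists>Y \<in> carrier_mat r r. elements_mat Y \<subseteq> Zmod n \<and>
           mat_mod n (X * Y) = mat_mod n (1\<^sub>m r) \<and> mat_mod n (Y * X) = mat_mod n (1\<^sub>m r))}"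

definition mat_trace :: "int mat \<Rightarrow> int" where
  "mat_trace X = (\<Sum>i<dim_row X. X $$ (i, i))"

text \<open>
  A multiplicative character is a group homomorphism from the unit group to the nonzero
  complex numbers. Its values outside \<^term>\<open>Zmod_units n\<close> are irrelevant and left unconstrained.
\<close>

definition mult_character :: "nat \<Rightarrow> (int \<Rightarrow> complex) \<Rightarrow> bool" where
  "mult_character n \<chi> \<longleftrightarrow>
     (\<forall>x \<in> Zmod_units n. \<chi> x \<noteq> 0) \<and>
     (\<forall>x \<in> Zmod_units n. \<forall>y \<in> Zmod_units n. \<chi> (x * y mod int n) = \<chi> x * \<chi> y)"

definition add_char :: "nat \<Rightarrow> int \<Rightarrow> int \<Rightarrow> complex" where
  "add_char n a x = exp (2 * of_real pi * \<i> * of_int a * of_int x / of_nat n)"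

text \<open>
  Factoring through the units modulo \<open>f\<close> presupposes the reduction map from residues modulo \<open>n\<close>
  to residues modulo \<open>f\<close>, hence the condition \<open>f dvd n\<close>. It cannot be dropped, as the congruence
  below is between least residues modulo \<open>n\<close>.
\<close>

definition factors_through :: "nat \<Rightarrow> (int \<Rightarrow> complex) \<Rightarrow> nat \<Rightarrow> bool" where
  "factors_through n \<chi> f \<longleftrightarrow>
     f dvd n \<and> (\<forall>c \<in> Zmod_units n. [c = 1] (mod int f) \<longrightarrow> \<chi> c = 1)"

definition conductor :: "nat \<Rightarrow> (int \<Rightarrow> complex) \<Rightarrow> nat" where
  "conductor n \<chi> = (LEAST f. f > 0 \<and> factors_through n \<chi> f)"

text \<open>
  The character modulo \<open>m\<close> through which \<open>\<chi>\<close> factors, for \<open>m\<close> a divisor of \<open>n\<close> divisible by the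
  conductor: the value at \<open>y\<close> is that of \<open>\<chi>\<close> at any unit modulo \<open>n\<close> that lifts \<open>y\<close>. Independence of the
  lift is \<open>induced_char_mod\<close> below.
\<close>

definition induced_char :: "nat \<Rightarrow> nat \<Rightarrow> (int \<Rightarrow> complex) \<Rightarrow> int \<Rightarrow> complex" where
  "induced_char n m \<chi> y = \<chi> (SOME c. c \<in> Zmod_units n \<and> c mod int m = y)"

definition gauss_sum :: "nat \<Rightarrow> (int \<Rightarrow> complex) \<Rightarrow> (int \<Rightarrow> complex) \<Rightarrow> complex" where
  "gauss_sum m \<psi> \<mu> = (\<Sum>x \<in> Zmod_units m. \<psi> x * \<mu> x)"

definition GL_gauss_sum ::
    "nat \<Rightarrow> nat \<Rightarrow> (int \<Rightarrow> complex) \<Rightarrow> (int \<Rightarrow> complex) \<Rightarrow> complex" where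
  "GL_gauss_sum r n \<chi> \<mu> =
     (\<Sum>X \<in> GL_Zmod r n. \<chi> (det X mod int n) * \<mu> (mat_trace X mod int n))"

lemma Zmod_units_iff:
  assumes "n > 0"
  shows "x \<in> Zmod_units n \<longleftrightarrow> 0 \<le> x \<and> x < int n \<and> coprime x (int n)"
proof -
  have "(\<exists>y \<in> Zmod n. [x * y = 1] (mod int n)) \<longleftrightarrow> (\<exists>y. [x * y = 1] (mod int n))"
  proof
    assume "\<exists>y. [x * y = 1] (mod int n)"
    then obtain y where "[x * y = 1] (mod int n)" by blast
    then have "[x * (y mod int n) = 1] (mod int n)"
      by (simp add: cong_def mod_mult_right_eq)
    moreover have "y mod int n \<in> Zmod n"
      using assms by (simp add: Zmod_def)
    ultimately show "\<exists>y \<in> Zmod n. [x * y = 1] (mod int n)" by blast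
  qed blast
  then show ?thesis
    by (auto simp: Zmod_units_def Zmod_def coprime_iff_invertible_int)
qed

lemma mod_in_Zmod_units:
  assumes "n > 0" "coprime c (int n)"
  shows "c mod int n \<in> Zmod_units n"
  using assms by (simp add: Zmod_units_iff)

lemma mult_character_one:
  assumes "n > 0" "mult_character n \<chi>"
  shows "\<chi> (1 mod int n) = 1"
proof -
  have u: "1 mod int n \<in> Zmod_units n"
    using assms by (simp add: mod_in_Zmod_units)
  then have "\<chi> (1 mod int n) * \<chi> (1 mod int n) = \<chi> (1 mod int n)"
    using assms by (metis mod_mult_eq mult_1 mult_character_def)
  with u show ?thesis
    using assms by (simp add: mult_character_def)
qed

lemma conductor_props:
  assumes "n > 0" "mult_character n \<chi>"
  shows "conductor n \<chi> > 0" "factors_through n \<chi> (conductor n \<chi>)"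
proof -
  have "n > 0 \<and> factors_through n \<chi> n"
    unfolding factors_through_def
  proof (intro conjI ballI impI)
    fix c assume "c \<in> Zmod_units n" "[c = 1] (mod int n)"
    then have "c = 1 mod int n"
      using assms by (simp add: Zmod_units_iff cong_def)
    then show "\<chi> c = 1"
      using mult_character_one[OF assms] by simp
  qed (use assms in auto)
  then have "conductor n \<chi> > 0 \<and> factors_through n \<chi> (conductor n \<chi>)"
    unfolding conductor_def by (rule LeastI)
  then show "conductor n \<chi> > 0" "factors_through n \<chi> (conductor n \<chi>)" by auto
qed

lemma induced_char_mod:
  assumes "n > 0" "mult_character n \<chi>" "m dvd n" "conductor n \<chi> dvd m" "coprime c (int n)"
  shows "induced_char n m \<chi> (c mod int m) = \<chi> (c mod int n)"
proof -
  define u where "u = c mod int n"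
  define v where "v = (SOME v. v \<in> Zmod_units n \<and> v mod int m = c mod int m)"
  have u: "u \<in> Zmod_units n"
    using assms by (simp add: u_def mod_in_Zmod_units)
  have um: "u mod int m = c mod int m"
    using assms(3) by (simp add: u_def mod_mod_cancel)
  have v: "v \<in> Zmod_units n \<and> v mod int m = c mod int m"
    unfolding v_def by (rule someI[of _ u]) (use u um in auto)
  obtain w where w: "w \<in> Zmod n" "[u * w = 1] (mod int n)"
    using u by (auto simp: Zmod_units_def)
  have wu: "w \<in> Zmod_units n"
    using w u by (auto simp: Zmod_units_def Zmod_def mult.commute)
  define t where "t = v * w mod int n"
  have f: "factors_through n \<chi> (conductor n \<chi>)"
    using conductor_props assms by blast
  have "coprime (v * w) (int n)"
    using v wu assms by (simp add: Zmod_units_iff)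
  then have t: "t \<in> Zmod_units n"
    using assms by (simp add: t_def mod_in_Zmod_units)
  have "[v = u] (mod int m)"
    using v um by (simp add: cong_def)
  then have "[v * w = u * w] (mod int m)"
    by (rule cong_scalar_right)
  moreover have "[u * w = 1] (mod int m)"
    using w(2) assms(3) by (meson cong_dvd_modulus int_dvd_int_iff)
  moreover have "[t = v * w] (mod int m)"
    using assms(3) by (simp add: t_def cong_def mod_mod_cancel)
  ultimately have "[t = 1] (mod int m)"
    by (meson cong_trans)
  then have "[t = 1] (mod int (conductor n \<chi>))"
    using assms(4) by (meson cong_dvd_modulus int_dvd_int_iff)
  then have "\<chi> t = 1"
    using f t by (simp add: factors_through_def)
  then have "\<chi> v * \<chi> w = 1"
    using assms v wu by (simp add: mult_character_def t_def)
  moreover have "\<chi> u * \<chi> w = 1"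
  proof -
    have "u * w mod int n = 1 mod int n"
      using w(2) by (simp add: cong_def)
    then show ?thesis
      using assms u wu mult_character_one[of n \<chi>] by (metis mult_character_def)
  qed
  ultimately have "\<chi> v = \<chi> u"
    by (metis mult.left_commute mult.right_neutral)
  then show ?thesis
    by (simp add: induced_char_def v_def u_def)
qed

end

(*
  Write m = n/d and b = a/d, so that lambda(x) = exp(2 pi i b x / m) with b prime to m.
  Left multiplication by a matrix U of determinant prime to n permutes GL_r(Z_n). Averaging over the
  upper unitriangular U replaces lambda(tr X) by lambda(tr X) times a sum of lambda over the entries
  below the diagonal, which leaves exactly the X that are upper triangular mod m. If f divides m,
  the summand depends only on X mod m, the sum over upper triangular residues mod m factors into
  r Gauss sums and a power of m, and every invertible residue mod m has the same number of invertible
  lifts, found by the Chinese remainder theorem one prime at a time. If f does not divide m, some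
  unit c = 1 (mod m) has chi(c) <> 1, and U = diag(c, 1, ..., 1) multiplies
  the whole sum by chi(c), so it vanishes.
*)

theory Submission
  imports Defs "HOL-Library.FuncSet"
begin

text \<open>The obstacle is that invertibility of X and the factor \<chi>(det X) tie all entries
  together, so the sum does not split over the entries. Unitriangular U have determinant 1, so
  averaging over them leaves \<chi> untouched; once X is triangular mod m, its determinant and its
  invertibility mod m are governed by the diagonal alone. Triangularity holds only mod m, however,
  so \<chi>(det X) can be read off that diagonal only because f | m lets \<chi> depend on det X mod
  m. Origin of the constants: a residue matrix mod m has d^(r^2) entrywise lifts. A prime p dividing
  n but not m keeps the proportion |GL_r(Z_p)| / p^(r^2), the product of the 1 - p^(-i), while
  primes dividing m cost nothing. The free entries above the diagonal give m^(r(r-1)/2), which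
  recombines with d^(r^2) into the stated powers of n and d. The unit c of the vanishing case exists
  because f divides every modulus through which \<chi> factors. As f is defined by minimality only,
  this rests on such moduli being closed under gcd.\<close>

section \<open>Matrices with prescribed sets of entries\<close>

text \<open>The entry set depends on the position so that full matrix sets, residue classes,
  unitriangular matrices and triangular residues are all instances, each a product set over the
  positions.\<close>

definition mats :: "nat \<Rightarrow> (nat \<Rightarrow> nat \<Rightarrow> 'a set) \<Rightarrow> 'a mat set" where
  "mats r A = {X \<in> carrier_mat r r. \<forall>i<r. \<forall>j<r. X $$ (i, j) \<in> A i j}"

lemma bij_betw_mats:
  "bij_betw (\<lambda>g. mat r r g) (PiE ({..<r} \<times> {..<r}) (\<lambda>(i, j). A i j)) (mats r A)"
proof (rule bij_betw_byWitness[where f' = "\<lambda>X. restrict (\<lambda>ij. X $$ ij) ({..<r} \<times> {..<r})"])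
  show "\<forall>g\<in>PiE ({..<r} \<times> {..<r}) (\<lambda>(i, j). A i j).
      restrict (\<lambda>ij. mat r r g $$ ij) ({..<r} \<times> {..<r}) = g"
  proof
    fix g assume g: "g \<in> PiE ({..<r} \<times> {..<r}) (\<lambda>(i, j). A i j)"
    have "restrict (\<lambda>ij. mat r r g $$ ij) ({..<r} \<times> {..<r}) = restrict g ({..<r} \<times> {..<r})"
      by (rule restrict_ext) (clarsimp simp: index_mat(1))
    also have "\<dots> = g"
      using g by (rule PiE_restrict)
    finally show "restrict (\<lambda>ij. mat r r g $$ ij) ({..<r} \<times> {..<r}) = g" .
  qed
  show "\<forall>X\<in>mats r A. mat r r (restrict (\<lambda>ij. X $$ ij) ({..<r} \<times> {..<r})) = X"
  proof
    fix X assume "X \<in> mats r A"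
    then have X: "dim_row X = r" "dim_col X = r"
      by (auto simp: mats_def)
    show "mat r r (restrict (\<lambda>ij. X $$ ij) ({..<r} \<times> {..<r})) = X"
      by (rule eq_matI) (simp_all add: X)
  qed
  show "(\<lambda>g. mat r r g) ` PiE ({..<r} \<times> {..<r}) (\<lambda>(i, j). A i j) \<subseteq> mats r A"
  proof (intro image_subsetI)
    fix g assume g: "g \<in> PiE ({..<r} \<times> {..<r}) (\<lambda>(i, j). A i j)"
    have "g (i, j) \<in> A i j" if "i < r" "j < r" for i j
      using PiE_mem[OF g, of "(i, j)"] that by simp
    then show "mat r r g \<in> mats r A"
      by (simp add: mats_def)
  qed
  show "(\<lambda>X. restrict (\<lambda>ij. X $$ ij) ({..<r} \<times> {..<r})) ` mats r A \<subseteq>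
      PiE ({..<r} \<times> {..<r}) (\<lambda>(i, j). A i j)"
  proof (intro image_subsetI)
    fix X assume "X \<in> mats r A"
    then show "restrict (\<lambda>ij. X $$ ij) ({..<r} \<times> {..<r}) \<in> PiE ({..<r} \<times> {..<r}) (\<lambda>(i, j). A i j)"
      by (intro PiE_I) (clarsimp simp: mats_def)+
  qed
qed

lemma finite_mats:
  assumes "\<And>i j. i < r \<Longrightarrow> j < r \<Longrightarrow> finite (A i j)"
  shows "finite (mats r A)"
proof -
  have "finite (PiE ({..<r} \<times> {..<r}) (\<lambda>(i, j). A i j))"
    using assms by (intro finite_PiE) auto
  then show ?thesis
    using bij_betw_finite[OF bij_betw_mats] by blast
qed

text \<open>The distributive law: a product of sums expands over choice functions, and a matrix is a
  choice of one entry per position.\<close>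

lemma sum_prod_mats:
  fixes h :: "nat \<Rightarrow> nat \<Rightarrow> 'a \<Rightarrow> 'b :: comm_semiring_1"
  assumes "\<And>i j. i < r \<Longrightarrow> j < r \<Longrightarrow> finite (A i j)"
  shows "(\<Sum>X\<in>mats r A. \<Prod>i<r. \<Prod>j<r. h i j (X $$ (i, j))) =
    (\<Prod>i<r. \<Prod>j<r. \<Sum>x\<in>A i j. h i j x)"
proof -
  have "(\<Sum>X\<in>mats r A. \<Prod>i<r. \<Prod>j<r. h i j (X $$ (i, j))) =
    (\<Sum>g\<in>PiE ({..<r} \<times> {..<r}) (\<lambda>(i, j). A i j). \<Prod>i<r. \<Prod>j<r. h i j (mat r r g $$ (i, j)))"
    by (rule sum.reindex_bij_betw[OF bij_betw_mats, symmetric])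
  also have "\<dots> = (\<Sum>g\<in>PiE ({..<r} \<times> {..<r}) (\<lambda>(i, j). A i j).
      \<Prod>p\<in>{..<r} \<times> {..<r}. (case p of (i, j) \<Rightarrow> h i j) (g p))"
    by (intro sum.cong refl) (simp add: prod.cartesian_product split_def)
  also have "\<dots> = (\<Prod>p\<in>{..<r} \<times> {..<r}. \<Sum>x\<in>(case p of (i, j) \<Rightarrow> A i j). (case p of (i, j) \<Rightarrow> h i j) x)"
    using assms by (subst prod_sum_PiE) auto
  also have "\<dots> = (\<Prod>i<r. \<Prod>j<r. \<Sum>x\<in>A i j. h i j x)"
    by (simp add: prod.cartesian_product split_def)
  finally show ?thesis .
qed

lemma card_mats:
  assumes "\<And>i j. i < r \<Longrightarrow> j < r \<Longrightarrow> finite (A i j)"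
  shows "card (mats r A) = (\<Prod>i<r. \<Prod>j<r. card (A i j))"
  using sum_prod_mats[of r A "\<lambda>_ _ _. 1 :: nat"] assms by simp

section \<open>Integer matrices modulo n and their invertibility\<close>

abbreviation mats_mod :: "nat \<Rightarrow> nat \<Rightarrow> int mat set" where
  "mats_mod r n \<equiv> mats r (\<lambda>_ _. Zmod n)"

lemma finite_Zmod [simp]: "finite (Zmod n)" and card_Zmod [simp]: "card (Zmod n) = n"
  by (simp_all add: Zmod_def)

lemma mod_in_Zmod [simp]: "n > 0 \<Longrightarrow> x mod int n \<in> Zmod n"
  by (simp add: Zmod_def)

lemma Zmod_mod_eq: "x \<in> Zmod n \<Longrightarrow> x mod int n = x"
  by (simp add: Zmod_def)

lemma mat_mod_carrier [simp]: "mat_mod n X \<in> carrier_mat r s \<longleftrightarrow> X \<in> carrier_mat r s"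
  by (auto simp: mat_mod_def)

lemma mat_mod_index:
  "X \<in> carrier_mat r s \<Longrightarrow> i < r \<Longrightarrow> j < s \<Longrightarrow> mat_mod n X $$ (i, j) = X $$ (i, j) mod int n"
  by (auto simp: mat_mod_def)

lemma mat_mod_eqI:
  assumes "X \<in> carrier_mat r s" "Y \<in> carrier_mat r s"
    "\<And>i j. i < r \<Longrightarrow> j < s \<Longrightarrow> [X $$ (i, j) = Y $$ (i, j)] (mod int n)"
  shows "mat_mod n X = mat_mod n Y"
  using assms by (auto simp: mat_mod_def cong_def intro!: eq_matI)

lemma mat_mod_eqD:
  assumes "mat_mod n X = mat_mod n Y" "X \<in> carrier_mat r s" "Y \<in> carrier_mat r s" "i < r" "j < s"
  shows "[X $$ (i, j) = Y $$ (i, j)] (mod int n)"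
  using assms by (metis cong_def mat_mod_index)

lemma mat_mod_in_mats [simp]: "n > 0 \<Longrightarrow> X \<in> carrier_mat r r \<Longrightarrow> mat_mod n X \<in> mats_mod r n"
  by (auto simp: mats_def mat_mod_index)

lemma mat_mod_id: "X \<in> mats_mod r n \<Longrightarrow> mat_mod n X = X"
  by (auto simp: mats_def mat_mod_def Zmod_mod_eq intro!: eq_matI)

lemma cong_mod_self: "[x mod n = x] (mod (n::int))"
  by (simp add: cong_def)

lemma index_mult_mat_sum:
  "X \<in> carrier_mat r s \<Longrightarrow> Y \<in> carrier_mat s t \<Longrightarrow> i < r \<Longrightarrow> j < t \<Longrightarrow>
    (X * Y) $$ (i, j) = (\<Sum>k<s. X $$ (i, k) * Y $$ (k, j))"
  by (auto simp: scalar_prod_def atLeast0LessThan)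

lemma mat_mod_mult_right:
  assumes "X \<in> carrier_mat r s" "Y \<in> carrier_mat s t"
  shows "mat_mod n (X * mat_mod n Y) = mat_mod n (X * Y)"
proof (rule mat_mod_eqI)
  fix i j assume "i < r" "j < t"
  then show "[(X * mat_mod n Y) $$ (i, j) = (X * Y) $$ (i, j)] (mod int n)"
    using assms by (auto simp: index_mult_mat_sum[where r = r and s = s and t = t] mat_mod_index[where r = s and s = t]
        simp del: index_mult_mat(1)
        intro!: cong_sum cong_mult cong_mod_self)
qed (use assms in auto)

lemma det_cong:
  assumes "X \<in> carrier_mat r r" "Y \<in> carrier_mat r r"
    "\<And>i j. i < r \<Longrightarrow> j < r \<Longrightarrow> [X $$ (i, j) = Y $$ (i, j)] (mod n)"
  shows "[det X = det Y] (mod n)"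
  unfolding det_def'[OF assms(1)] det_def'[OF assms(2)]
proof (intro cong_sum cong_mult cong_prod cong_refl)
  fix p i assume "p \<in> {p. p permutes {0..<r}}" "i \<in> {0..<r}"
  then show "[X $$ (i, p i) = Y $$ (i, p i)] (mod n)"
    using permutes_in_image[of p "{0..<r}" i] by (intro assms(3)) auto
qed

lemma det_mat_mod: "X \<in> carrier_mat r r \<Longrightarrow> [det (mat_mod n X) = det X] (mod int n)"
  by (rule det_cong[of _ r]) (auto simp: mat_mod_index cong_mod_self)

lemma mat_trace_mat_mod: "X \<in> carrier_mat r r \<Longrightarrow> [mat_trace (mat_mod n X) = mat_trace X] (mod int n)"
  by (auto simp: mat_trace_def mat_mod_def intro!: cong_sum cong_mod_self)

lemma elements_mat_subset_iff:
  "X \<in> carrier_mat r r \<Longrightarrow> elements_mat X \<subseteq> A \<longleftrightarrow> (\<forall>i<r. \<forall>j<r. X $$ (i, j) \<in> A)"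
  by (auto dest!: elements_matD)

text \<open>Multiplying by the adjugate turns U into the scalar \<open>det U\<close>, which is a
  unit modulo n.\<close>

lemma mat_mod_cancel_left:
  assumes "U \<in> carrier_mat r r" "coprime (det U) (int n)" "X \<in> carrier_mat r r" "Y \<in> carrier_mat r r"
    "mat_mod n (U * X) = mat_mod n (U * Y)"
  shows "mat_mod n X = mat_mod n Y"
proof (rule mat_mod_eqI)
  note adj = adj_mat[OF assms(1)]
  have eq: "adj_mat U * (U * Z) = det U \<cdot>\<^sub>m Z" if "Z \<in> carrier_mat r r" for Z
  proof -
    have "adj_mat U * (U * Z) = (adj_mat U * U) * Z"
      using adj assms that by (intro assoc_mult_mat[symmetric]) auto
    then show ?thesis
      using adj that by (simp add: mult_smult_assoc_mat[of _ r r])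
  qed
  have "mat_mod n (adj_mat U * (U * X)) = mat_mod n (adj_mat U * (U * Y))"
    using adj assms mat_mod_mult_right[of "adj_mat U" r r "U * X" r n]
      mat_mod_mult_right[of "adj_mat U" r r "U * Y" r n] by auto
  then have *: "mat_mod n (det U \<cdot>\<^sub>m X) = mat_mod n (det U \<cdot>\<^sub>m Y)"
    using assms by (simp add: eq)
  fix i j assume "i < r" "j < r"
  then have "[det U * X $$ (i, j) = det U * Y $$ (i, j)] (mod int n)"
    using mat_mod_eqD[OF *, of r r i j] assms by auto
  then show "[X $$ (i, j) = Y $$ (i, j)] (mod int n)"
    using assms(2) by (simp add: cong_mult_lcancel)
qed (use assms in auto)

text \<open>Determinants are multiplicative mod n, so an inverse matrix gives an inverse of the
  determinant. Conversely, the adjugate scaled by an inverse w of the determinant is an inverse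
  matrix.\<close>

lemma GL_Zmod_eq:
  assumes "n > 0"
  shows "GL_Zmod r n = {X \<in> mats_mod r n. coprime (det X) (int n)}"
proof (intro equalityI subsetI)
  fix X assume "X \<in> GL_Zmod r n"
  then obtain Y where X: "X \<in> mats_mod r n" and Xc: "X \<in> carrier_mat r r" and Y: "Y \<in> carrier_mat r r"
    "mat_mod n (X * Y) = mat_mod n (1\<^sub>m r)"
    by (auto simp: GL_Zmod_def mats_def elements_mat_subset_iff)
  have "[det (X * Y) = det (1\<^sub>m r)] (mod int n)"
    using Y Xc by (intro det_cong[of _ r] mat_mod_eqD[OF Y(2), of r r]) auto
  then have "[det X * det Y = 1] (mod int n)"
    using Xc Y by (simp add: det_mult)
  then show "X \<in> {X \<in> mats_mod r n. coprime (det X) (int n)}"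
    using X by (auto simp: coprime_iff_invertible_int)
next
  fix X assume "X \<in> {X \<in> mats_mod r n. coprime (det X) (int n)}"
  then have X: "X \<in> mats_mod r n" "X \<in> carrier_mat r r" "coprime (det X) (int n)"
    by (auto simp: mats_def)
  then obtain w where w: "[det X * w = 1] (mod int n)"
    by (auto simp: coprime_iff_invertible_int)
  note adj = adj_mat[OF X(2)]
  define Y where "Y = w \<cdot>\<^sub>m adj_mat X"
  have Y: "Y \<in> carrier_mat r r"
    using adj by (simp add: Y_def)
  have one: "mat_mod n (w \<cdot>\<^sub>m (det X \<cdot>\<^sub>m 1\<^sub>m r)) = mat_mod n (1\<^sub>m r)"
    using w by (intro mat_mod_eqI[of _ r r]) (auto simp: mult.commute)
  have "mat_mod n (X * mat_mod n Y) = mat_mod n (1\<^sub>m r)"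
    using mat_mod_mult_right[of X r r Y r n] X Y adj one by (simp add: Y_def mult_smult_distrib)
  moreover have "mat_mod n (mat_mod n Y * X) = mat_mod n (1\<^sub>m r)"
  proof -
    have "mat_mod n (mat_mod n Y * X) = mat_mod n (Y * X)"
      using X Y by (intro mat_mod_eqI[of _ r r])
        (auto simp: index_mult_mat_sum[where s = r and r = r and t = r] mat_mod_index[where r = r and s = r]
          simp del: index_mult_mat(1) intro!: cong_sum cong_mult cong_mod_self)
    then show ?thesis
      using X Y adj one by (simp add: Y_def mult_smult_assoc_mat)
  qed
  moreover have "mat_mod n Y \<in> mats_mod r n"
    using assms Y by simp
  ultimately show "X \<in> GL_Zmod r n"
    unfolding GL_Zmod_def using X Y
    by (auto simp: elements_mat_subset_iff mats_def intro!: bexI[of _ "mat_mod n Y"])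
qed

text \<open>Injectivity is cancellation of U, and an injective self-map of a finite set is onto, so
  no inverse of U has to be constructed.\<close>

lemma bij_betw_mult_GL:
  assumes "n > 0" "U \<in> carrier_mat r r" "coprime (det U) (int n)"
  shows "bij_betw (\<lambda>X. mat_mod n (U * X)) (GL_Zmod r n) (GL_Zmod r n)"
proof -
  have fin: "finite (GL_Zmod r n)"
    using finite_mats[of r "\<lambda>_ _. Zmod n"] assms(1) by (simp add: GL_Zmod_eq)
  have inj: "inj_on (\<lambda>X. mat_mod n (U * X)) (GL_Zmod r n)"
  proof (rule inj_onI)
    fix X Y assume "X \<in> GL_Zmod r n" "Y \<in> GL_Zmod r n" "mat_mod n (U * X) = mat_mod n (U * Y)"
    then show "X = Y"
      using mat_mod_cancel_left[OF assms(2,3), of X Y] assms(1)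
      by (metis (no_types, lifting) GL_Zmod_eq mat_mod_id mats_def mem_Collect_eq)
  qed
  have "(\<lambda>X. mat_mod n (U * X)) ` GL_Zmod r n \<subseteq> GL_Zmod r n"
  proof (intro image_subsetI)
    fix X assume "X \<in> GL_Zmod r n"
    then have X: "X \<in> carrier_mat r r" "coprime (det X) (int n)"
      using assms(1) by (auto simp: GL_Zmod_eq mats_def)
    have "[det (mat_mod n (U * X)) = det U * det X] (mod int n)"
      using det_mat_mod[of "U * X" r n] assms X by (simp add: det_mult)
    moreover have "coprime (det U * det X) (int n)"
      using assms X by simp
    ultimately have "coprime (det (mat_mod n (U * X))) (int n)"
      by (metis cong_imp_coprime cong_sym)
    then show "mat_mod n (U * X) \<in> GL_Zmod r n"
      using assms X by (simp add: GL_Zmod_eq)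
  qed
  then show ?thesis
    using endo_inj_surj[OF fin _ inj] inj by (simp add: bij_betw_def)
qed

lemma finite_GL_Zmod [simp]: "n > 0 \<Longrightarrow> finite (GL_Zmod r n)"
  using finite_mats[of r "\<lambda>_ _. Zmod n"] by (simp add: GL_Zmod_eq)

lemma GL_Zmod_carrier: "X \<in> GL_Zmod r n \<Longrightarrow> X \<in> carrier_mat r r"
  by (simp add: GL_Zmod_def)

lemma GL_Zmod_mats: "n > 0 \<Longrightarrow> X \<in> GL_Zmod r n \<Longrightarrow> X \<in> mats_mod r n"
  by (simp add: GL_Zmod_eq)

lemma mat_mod_GL_Zmod:
  assumes "n > 0" "X \<in> carrier_mat r r" "coprime (det X) (int n)"
  shows "mat_mod n X \<in> GL_Zmod r n"
proof -
  have "coprime (det (mat_mod n X)) (int n)"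
    using cong_imp_coprime[OF cong_sym[OF det_mat_mod[OF assms(2)]]] assms(3) by simp
  then show ?thesis
    using assms by (simp add: GL_Zmod_eq)
qed

section \<open>The order of GL_r over a prime field\<close>

definition GL_first_col :: "nat \<Rightarrow> nat \<Rightarrow> (nat \<Rightarrow> int) \<Rightarrow> int mat set" where
  "GL_first_col r n v = {X \<in> GL_Zmod r n. \<forall>i<r. X $$ (i, 0) = v i}"

text \<open>Left multiplication by U acts on each column separately, so it carries the invertible
  matrices with first column v bijectively to those with first column U v.\<close>

lemma card_GL_first_col_eq:
  assumes "n > 0" "r > 0" "U \<in> carrier_mat r r" "coprime (det U) (int n)"
    and v: "\<And>i. i < r \<Longrightarrow> v i \<in> Zmod n" and v': "\<And>i. i < r \<Longrightarrow> v' i \<in> Zmod n"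
    and eq: "\<And>i. i < r \<Longrightarrow> [(\<Sum>k<r. U $$ (i, k) * v k) = v' i] (mod int n)"
  shows "card (GL_first_col r n v) = card (GL_first_col r n v')"
proof -
  let ?f = "\<lambda>X. mat_mod n (U * X)"
  note bij = bij_betw_mult_GL[OF assms(1,3,4)]
  have iff: "?f X \<in> GL_first_col r n v' \<longleftrightarrow> X \<in> GL_first_col r n v" if X: "X \<in> GL_Zmod r n" for X
  proof -
    have Xc: "X \<in> carrier_mat r r" and XZ: "X \<in> mats_mod r n"
      using X assms(1) by (auto simp: GL_Zmod_carrier GL_Zmod_mats)
    have fX: "?f X \<in> GL_Zmod r n"
      using bij X by (auto simp: bij_betw_def)
    have entry: "?f X $$ (i, 0) = (\<Sum>k<r. U $$ (i, k) * X $$ (k, 0)) mod int n" if "i < r" for i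
      using that assms Xc
      by (simp add: mat_mod_index[where r = r and s = r] index_mult_mat_sum[where r = r and s = r and t = r]
          del: index_mult_mat(1))
    show ?thesis
    proof
      assume "X \<in> GL_first_col r n v"
      then have "?f X $$ (i, 0) = v' i" if "i < r" for i
        using eq[OF that] v'[OF that] by (simp add: entry[OF that] GL_first_col_def cong_def Zmod_mod_eq)
      then show "?f X \<in> GL_first_col r n v'"
        using fX by (simp add: GL_first_col_def)
    next
      assume fc: "?f X \<in> GL_first_col r n v'"
      (* Square matrices with all columns equal, so that cancellation of U applies. *)
      define Z where "Z = mat r r (\<lambda>(i, j). v i)"
      define Z' where "Z' = mat r r (\<lambda>(i, j). X $$ (i, 0))"
      have Z: "Z \<in> carrier_mat r r" "Z' \<in> carrier_mat r r"
        by (simp_all add: Z_def Z'_def)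
      have "mat_mod n (U * Z) = mat_mod n (U * Z')"
      proof (rule mat_mod_eqI[of _ r r])
        fix i j assume ij: "i < r" "j < r"
        have "[(\<Sum>k<r. U $$ (i, k) * v k) = v' i] (mod int n)"
          using eq ij by blast
        also have "v' i = (\<Sum>k<r. U $$ (i, k) * X $$ (k, 0)) mod int n"
          using fc ij entry by (simp add: GL_first_col_def)
        also have "[\<dots> = (\<Sum>k<r. U $$ (i, k) * X $$ (k, 0))] (mod int n)"
          by (rule cong_mod_self)
        finally show "[(U * Z) $$ (i, j) = (U * Z') $$ (i, j)] (mod int n)"
          using ij assms(3) Z
          by (simp add: index_mult_mat_sum[where r = r and s = r and t = r] Z_def Z'_def del: index_mult_mat(1))
      qed (use assms(3) Z in auto)
      then have "mat_mod n Z = mat_mod n Z'"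
        using mat_mod_cancel_left assms Z by blast
      then have "[v i = X $$ (i, 0)] (mod int n)" if "i < r" for i
        using mat_mod_eqD[of n Z Z' r r i 0] Z that by (simp add: Z_def Z'_def)
      moreover have "X $$ (i, 0) \<in> Zmod n" if "i < r" for i
        using XZ that assms(2) by (auto simp: mats_def)
      ultimately have "X $$ (i, 0) = v i" if "i < r" for i
        using that v[OF that] by (metis cong_def Zmod_mod_eq)
      then show "X \<in> GL_first_col r n v"
        using X by (simp add: GL_first_col_def)
    qed
  qed
  have "bij_betw ?f (GL_first_col r n v) (GL_first_col r n v')"
  proof (rule bij_betw_subset[OF bij])
    show "GL_first_col r n v \<subseteq> GL_Zmod r n"
      by (auto simp: GL_first_col_def)
    show "?f ` GL_first_col r n v = GL_first_col r n v'"
    proof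
      show "?f ` GL_first_col r n v \<subseteq> GL_first_col r n v'"
        using iff by (auto simp: GL_first_col_def)
      show "GL_first_col r n v' \<subseteq> ?f ` GL_first_col r n v"
      proof
        fix Y assume Y: "Y \<in> GL_first_col r n v'"
        then have "Y \<in> ?f ` GL_Zmod r n"
          using bij by (auto simp: bij_betw_def GL_first_col_def)
        then show "Y \<in> ?f ` GL_first_col r n v"
          using iff Y by auto
      qed
    qed
  qed
  then show ?thesis
    by (rule bij_betw_same_card)
qed

definition unit_col :: "nat \<Rightarrow> int" where
  "unit_col i = (if i = 0 then 1 else 0)"

text \<open>A unit at the head is a pivot: row operations turn the column into the first basis
  vector. The bound \<open>n > 1\<close> makes the entry 1 a least residue.\<close>

lemma card_GL_first_col_unit_head:
  assumes "n > 1" "r > 0" and v: "\<And>i. i < r \<Longrightarrow> v i \<in> Zmod n" and "coprime (v 0) (int n)"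
  shows "card (GL_first_col r n v) = card (GL_first_col r n unit_col)"
proof -
  obtain w where w: "[v 0 * w = 1] (mod int n)"
    using assms(4) by (auto simp: coprime_iff_invertible_int)
  \<comment> \<open>Row 0 is scaled by the inverse w of \<open>v 0\<close>, and \<open>v i\<close>
    times the scaled row is subtracted from row i. The matrix is lower triangular with diagonal w,
    1, ..., 1.\<close>
  define U where "U = mat r r (\<lambda>(i, j). if j = 0 then if i = 0 then w else - w * v i else if i = j then 1 else 0)"
  have U: "U \<in> carrier_mat r r"
    by (simp add: U_def)
  obtain s where s: "r = Suc s"
    using assms(2) by (cases r) auto
  have "det U = prod_list (diag_mat U)"
    using U by (intro det_lower_triangular[of r]) (auto simp: U_def)
  also have "\<dots> = w"
    by (simp add: prod_list_diag_prod U_def s prod.atLeast0_lessThan_Suc_shift del: prod.op_ivl_Suc)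
  finally have "det U = w" .
  moreover have "coprime w (int n)"
    using w by (auto simp: coprime_iff_invertible_int mult.commute)
  ultimately have co: "coprime (det U) (int n)"
    by simp
  have sum: "(\<Sum>k<r. U $$ (i, k) * v k) = (if i = 0 then w * v 0 else v i - v i * (w * v 0))" if "i < r" for i
  proof (cases i)
    case 0
    then show ?thesis
      by (simp add: s U_def sum.lessThan_Suc_shift del: sum.lessThan_Suc)
  next
    case (Suc k)
    have "(\<Sum>l<s. U $$ (i, Suc l) * v (Suc l)) = (\<Sum>l<s. if l = k then v (Suc l) else 0)"
      using Suc that by (intro sum.cong) (auto simp: s U_def)
    also have "\<dots> = v i"
      using Suc that s by simp
    finally show ?thesis
      using Suc that by (simp add: s U_def sum.lessThan_Suc_shift del: sum.lessThan_Suc)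
  qed
  have "[(\<Sum>k<r. U $$ (i, k) * v k) = unit_col i] (mod int n)" if "i < r" for i
  proof (cases "i = 0")
    case True
    then show ?thesis
      using w unfolding sum[OF that] by (simp add: unit_col_def mult.commute)
  next
    case False
    have "[v i - v i * (w * v 0) = v i - v i * 1] (mod int n)"
      using w by (intro cong_diff cong_mult cong_refl) (simp add: mult.commute)
    then show ?thesis
      using False unfolding sum[OF that] by (simp add: unit_col_def)
  qed
  then show ?thesis
    using assms U co by (intro card_GL_first_col_eq[of n r U]) (auto simp: unit_col_def Zmod_def)
qed

text \<open>Over a field all nonzero columns lie in one orbit under row operations. If the head
  vanishes, a nonzero entry is first brought there.\<close>

lemma card_GL_first_col_prime:
  assumes p: "prime p" and v: "\<And>i. i < r \<Longrightarrow> v i \<in> Zmod p" and k: "k < r" "v k \<noteq> 0"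
  shows "card (GL_first_col r p v) = card (GL_first_col r p unit_col)"
proof -
  have p1: "p > 1"
    using p prime_gt_1_nat by blast
  have r: "r > 0"
    using k by simp
  have cop: "coprime x (int p)" if "x \<in> Zmod p" "x \<noteq> 0" for x
  proof -
    have "\<not> int p dvd x"
      using that zdvd_not_zless[of x "int p"] by (auto simp: Zmod_def)
    moreover have "prime (int p)"
      using p by simp
    ultimately have "coprime (int p) x"
      using prime_imp_coprime by blast
    then show ?thesis
      by (simp add: coprime_commute)
  qed
  show ?thesis
  proof (cases "v 0 = 0")
    case False
    then show ?thesis
      using v r p1 by (intro card_GL_first_col_unit_head cop) auto
  next
    case True
    then have k0: "k > 0"
      using k by (cases k) auto
    \<comment> \<open>Adds row k to row 0. Since \<open>v 0 = 0\<close>, only the head of the column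
      changes, and it becomes \<open>v k\<close>.\<close>
    define U :: "int mat" where "U = mat r r (\<lambda>(i, j). if i = j \<or> i = 0 \<and> j = k then 1 else 0)"
    define v' where "v' = v(0 := v k)"
    have U: "U \<in> carrier_mat r r"
      by (simp add: U_def)
    have "det U = prod_list (diag_mat U)"
      using U k0 by (intro det_upper_triangular[of _ r]) (auto simp: U_def)
    also have "\<dots> = 1"
      by (simp add: prod_list_diag_prod U_def)
    finally have co: "coprime (det U) (int p)"
      by simp
    have "(\<Sum>l<r. U $$ (i, l) * v l) = v' i" if "i < r" for i
    proof -
      have "(\<Sum>l<r. U $$ (i, l) * v l) = (\<Sum>l<r. if l = (if i = 0 then k else i) then v l else 0)"
        using that True by (intro sum.cong) (auto simp: U_def)
      also have "\<dots> = v' i"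
        using that k by (simp add: v'_def)
      finally show ?thesis .
    qed
    then have "card (GL_first_col r p v) = card (GL_first_col r p v')"
      using U co v p1 r k by (intro card_GL_first_col_eq[of p r U]) (auto simp: v'_def)
    also have "\<dots> = card (GL_first_col r p unit_col)"
      using v k p1 r by (intro card_GL_first_col_unit_head cop) (auto simp: v'_def)
    finally show ?thesis .
  qed
qed

lemma det_first_col_unit:
  assumes "X \<in> carrier_mat (Suc s) (Suc s)" "\<And>i. i < Suc s \<Longrightarrow> X $$ (i, 0) = unit_col i"
  shows "det X = det (mat_delete X 0 0)"
proof -
  have "det X = (\<Sum>i<Suc s. X $$ (i, 0) * cofactor X i 0)"
    using assms by (intro laplace_expansion_column) auto
  also have "\<dots> = (\<Sum>i<Suc s. if i = 0 then cofactor X i 0 else 0)"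
    using assms(2) by (intro sum.cong) (auto simp: unit_col_def)
  also have "\<dots> = cofactor X 0 0"
    by (simp add: sum.lessThan_Suc_shift del: sum.lessThan_Suc)
  finally show ?thesis
    by (simp add: cofactor_def)
qed

lemma mat_delete_0_0_index:
  "X \<in> carrier_mat (Suc s) (Suc s) \<Longrightarrow> i < s \<Longrightarrow> j < s \<Longrightarrow>
    mat_delete X 0 0 $$ (i, j) = X $$ (Suc i, Suc j)"
  by (auto simp: mat_delete_def)

text \<open>By Laplace expansion along the first column, deleting row 0 and column 0 preserves the
  determinant. The rest of row 0 is then free, which gives s independent entries.\<close>

lemma card_GL_first_col_unit_col:
  assumes "n > 1"
  shows "card (GL_first_col (Suc s) n unit_col) = n ^ s * card (GL_Zmod s n)"
proof -
  let ?C = "GL_first_col (Suc s) n unit_col"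
  \<comment> \<open>Entry sets of the fibre over Y: the first column is fixed, the rest of row 0 is
    free, and the remaining block is Y with both indices shifted by one.\<close>
  let ?A = "\<lambda>Y i j. if j = 0 then {unit_col i} else if i = 0 then Zmod n else {Y $$ (i - 1, j - 1)}"
  have n0: "n > 0"
    using assms by simp
  have del: "mat_delete X 0 0 \<in> GL_Zmod s n" if "X \<in> ?C" for X
  proof -
    have X: "X \<in> mats_mod (Suc s) n" "coprime (det X) (int n)" "X \<in> carrier_mat (Suc s) (Suc s)"
      "\<And>i. i < Suc s \<Longrightarrow> X $$ (i, 0) = unit_col i"
      using that n0 by (auto simp: GL_first_col_def GL_Zmod_eq mats_def)
    have dc: "mat_delete X 0 0 \<in> carrier_mat s s"
      using mat_delete_carrier[OF X(3)] by simp
    have "coprime (det (mat_delete X 0 0)) (int n)"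
      using det_first_col_unit[OF X(3,4)] X(2) by simp
    moreover have "mat_delete X 0 0 \<in> mats_mod s n"
      using X(1,3) dc by (simp add: mats_def mat_delete_0_0_index)
    ultimately show ?thesis
      using n0 by (simp add: GL_Zmod_eq)
  qed
  have fibre: "{X \<in> ?C. mat_delete X 0 0 = Y} = mats (Suc s) (?A Y)" if Y: "Y \<in> GL_Zmod s n" for Y
  proof (intro equalityI subsetI)
    fix X assume X: "X \<in> {X \<in> ?C. mat_delete X 0 0 = Y}"
    then have Xc: "X \<in> carrier_mat (Suc s) (Suc s)" and XZ: "X \<in> mats_mod (Suc s) n"
      using n0 by (auto simp: GL_first_col_def GL_Zmod_carrier GL_Zmod_mats)
    have "X $$ (i, j) \<in> ?A Y i j" if ij: "i < Suc s" "j < Suc s" for i j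
    proof (cases i; cases j)
      fix i' j' assume "i = Suc i'" "j = Suc j'"
      then show ?thesis
        using X ij Xc mat_delete_0_0_index[OF Xc, of i' j'] by auto
    qed (use X XZ ij in \<open>auto simp: GL_first_col_def mats_def\<close>)
    then show "X \<in> mats (Suc s) (?A Y)"
      using Xc by (simp add: mats_def)
  next
    fix X assume X: "X \<in> mats (Suc s) (?A Y)"
    then have Xc: "X \<in> carrier_mat (Suc s) (Suc s)"
      by (simp add: mats_def)
    have XA: "X $$ (i, j) \<in> ?A Y i j" if "i < Suc s" "j < Suc s" for i j
      using X that by (simp add: mats_def)
    have Yc: "Y \<in> carrier_mat s s" and YZ: "Y \<in> mats_mod s n" and Yd: "coprime (det Y) (int n)"
      using Y n0 by (auto simp: GL_Zmod_eq mats_def)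
    have col: "X $$ (i, 0) = unit_col i" if "i < Suc s" for i
      using XA[OF that, of 0] by simp
    have dY: "mat_delete X 0 0 = Y"
    proof (rule eq_matI)
      fix i j assume "i < dim_row Y" "j < dim_col Y"
      then show "mat_delete X 0 0 $$ (i, j) = Y $$ (i, j)"
        using XA[of "Suc i" "Suc j"] Yc by (simp add: mat_delete_0_0_index[OF Xc])
    qed (use Xc Yc in auto)
    have "X $$ (i, j) \<in> Zmod n" if "i < Suc s" "j < Suc s" for i j
      using XA[OF that] YZ that assms
      by (cases i; cases j) (auto simp: mats_def unit_col_def Zmod_def split: if_splits)
    then have "X \<in> mats_mod (Suc s) n"
      using Xc by (simp add: mats_def)
    moreover have "det X = det Y"
      using det_first_col_unit[OF Xc col] dY by simp
    ultimately show "X \<in> {X \<in> ?C. mat_delete X 0 0 = Y}"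
      using n0 Yd dY col by (simp add: GL_first_col_def GL_Zmod_eq)
  qed
  have cardA: "card (mats (Suc s) (?A Y)) = n ^ s" for Y
  proof -
    have "card (mats (Suc s) (?A Y)) = (\<Prod>i<Suc s. \<Prod>j<Suc s. card (?A Y i j))"
      by (rule card_mats) simp
    also have "\<dots> = n ^ s"
      by (simp add: prod.lessThan_Suc_shift del: prod.lessThan_Suc)
    finally show ?thesis .
  qed
  have "finite ?C"
    using n0 by (simp add: GL_first_col_def)
  then have "card ?C = (\<Sum>Y\<in>GL_Zmod s n. \<Sum>X\<in>{X \<in> ?C. mat_delete X 0 0 = Y}. 1)"
    using del n0 by (subst sum.group) auto
  also have "\<dots> = (\<Sum>Y\<in>GL_Zmod s n. n ^ s)"
    using cardA by (intro sum.cong refl) (simp add: fibre)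
  finally show ?thesis
    by (simp add: mult.commute)
qed

text \<open>Count by the first column. The zero column makes the determinant vanish, and each of the
  other \<open>p ^ Suc s - 1\<close> columns admits as many completions as the first basis
  vector.\<close>

lemma card_GL_Suc_prime:
  assumes p: "prime p"
  shows "card (GL_Zmod (Suc s) p) = (p ^ Suc s - 1) * (p ^ s * card (GL_Zmod s p))"
proof -
  let ?r = "Suc s"
  \<comment> \<open>Columns are extensional functions, so that equal columns are equal objects and
    there are exactly \<open>p ^ Suc s\<close> of them.\<close>
  let ?V = "PiE {..<?r} (\<lambda>_. Zmod p)"
  let ?z = "restrict (\<lambda>_. 0 :: int) {..<?r}"
  have p1: "p > 1" and p0: "p > 0"
    using p prime_gt_1_nat[of p] by auto
  have fin: "finite ?V"
    by (intro finite_PiE) auto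
  have z: "?z \<in> ?V"
    using p0 by (auto simp: Zmod_def)
  have col: "restrict (\<lambda>i. X $$ (i, 0)) {..<?r} \<in> ?V" if "X \<in> GL_Zmod ?r p" for X
    using GL_Zmod_mats[OF p0 that] by (auto simp: mats_def)
  then have img: "(\<lambda>X. restrict (\<lambda>i. X $$ (i, 0)) {..<?r}) ` GL_Zmod ?r p \<subseteq> ?V"
    by blast
  have fibre: "{X \<in> GL_Zmod ?r p. restrict (\<lambda>i. X $$ (i, 0)) {..<?r} = v} = GL_first_col ?r p v"
    if "v \<in> ?V" for v
  proof -
    have "restrict (\<lambda>i. X $$ (i, 0)) {..<?r} = v \<longleftrightarrow> (\<forall>i<?r. X $$ (i, 0) = v i)" for X :: "int mat"
    proof
      assume "restrict (\<lambda>i. X $$ (i, 0)) {..<?r} = v"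
      then have "v i = restrict (\<lambda>i. X $$ (i, 0)) {..<?r} i" for i
        by simp
      then show "\<forall>i<?r. X $$ (i, 0) = v i"
        by simp
    next
      assume "\<forall>i<?r. X $$ (i, 0) = v i"
      then have "restrict (\<lambda>i. X $$ (i, 0)) {..<?r} = restrict v {..<?r}"
        by (intro restrict_ext) simp
      then show "restrict (\<lambda>i. X $$ (i, 0)) {..<?r} = v"
        using PiE_restrict[OF that] by simp
    qed
    then show ?thesis
      by (simp add: GL_first_col_def)
  qed
  have zero: "GL_first_col ?r p ?z = {}"
  proof -
    have False if "X \<in> GL_first_col ?r p ?z" for X
    proof -
      have X: "X \<in> carrier_mat ?r ?r" "coprime (det X) (int p)" "\<And>i. i < ?r \<Longrightarrow> X $$ (i, 0) = 0"
        using that p0 by (auto simp: GL_first_col_def GL_Zmod_eq mats_def)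
      have "det X = (\<Sum>i<?r. X $$ (i, 0) * cofactor X i 0)"
        using X by (intro laplace_expansion_column) auto
      also have "\<dots> = 0"
        using X(3) by (intro sum.neutral) auto
      finally show False
        using X(2) p1 by simp
    qed
    then show ?thesis by blast
  qed
  have nonzero: "card (GL_first_col ?r p v) = p ^ s * card (GL_Zmod s p)" if "v \<in> ?V - {?z}" for v
  proof -
    have "\<exists>k<?r. v k \<noteq> 0"
    proof (rule ccontr)
      assume "\<not> (\<exists>k<?r. v k \<noteq> 0)"
      then have "v = ?z"
        using that by (intro PiE_ext[of v "{..<?r}" "\<lambda>_. Zmod p" ?z] z) auto
      with that show False by simp
    qed
    then show ?thesis
      using that card_GL_first_col_prime[OF p, of ?r v] card_GL_first_col_unit_col[OF p1] by auto
  qed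
  have "card (GL_Zmod ?r p) =
      (\<Sum>v\<in>?V. \<Sum>X\<in>{X \<in> GL_Zmod ?r p. restrict (\<lambda>i. X $$ (i, 0)) {..<?r} = v}. 1)"
    using sum.group[OF finite_GL_Zmod[OF p0] fin img, of "\<lambda>_. 1 :: nat"] by simp
  also have "\<dots> = (\<Sum>v\<in>?V. card (GL_first_col ?r p v))"
    by (intro sum.cong refl) (simp add: fibre)
  also have "\<dots> = (\<Sum>v\<in>?V - {?z}. card (GL_first_col ?r p v))"
    using sum.remove[OF fin z, of "\<lambda>v. card (GL_first_col ?r p v)"] zero by simp
  also have "\<dots> = (\<Sum>v\<in>?V - {?z}. p ^ s * card (GL_Zmod s p))"
    by (intro sum.cong refl nonzero)
  also have "\<dots> = (p ^ Suc s - 1) * (p ^ s * card (GL_Zmod s p))"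
    using fin z by (simp add: card_PiE)
  finally show ?thesis .
qed

text \<open>Pulling \<open>p ^ Suc s\<close> out of \<open>p ^ Suc s - 1\<close> leaves the factor 1
  - p^(-(s+1)), and the exponents add up to (s+1)^2. This form exhibits the product as the
  proportion of invertible matrices among all p^(r^2).\<close>

lemma card_GL_prime:
  assumes p: "prime p"
  shows "of_nat (card (GL_Zmod r p)) =
    (of_nat p ^ (r * r) * (\<Prod>i = 1..r. 1 - 1 / of_nat p ^ i) :: 'a :: field_char_0)"
proof (induction r)
  case 0
  have "GL_Zmod 0 p = {mat 0 0 (\<lambda>_. 0)}"
    using p by (auto simp: GL_Zmod_eq mats_def prime_gt_0_nat intro!: eq_matI)
  then show ?case by simp
next
  case (Suc s)
  have p0: "(of_nat p :: 'a) \<noteq> 0" and ge: "p ^ Suc s \<ge> 1"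
    using prime_gt_0_nat[OF p] by auto
  have "of_nat (card (GL_Zmod (Suc s) p)) =
      (of_nat p ^ Suc s - 1) * (of_nat p ^ s * of_nat (card (GL_Zmod s p)) :: 'a)"
    unfolding card_GL_Suc_prime[OF p] using ge by (simp only: of_nat_mult of_nat_diff of_nat_power of_nat_1)
  also have "\<dots> = (of_nat p ^ Suc s * (1 - 1 / of_nat p ^ Suc s)) * (of_nat p ^ s * of_nat (card (GL_Zmod s p)))"
    using p0 by (simp add: field_simps)
  also have "\<dots> = of_nat p ^ (Suc s + s + s * s) * ((1 - 1 / of_nat p ^ Suc s) * (\<Prod>i = 1..s. 1 - 1 / of_nat p ^ i))"
    unfolding Suc.IH power_add by (simp only: mult_ac)
  also have "Suc s + s + s * s = Suc s * Suc s"
    by simp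
  also have "(1 - 1 / of_nat p ^ Suc s) * (\<Prod>i = 1..s. 1 - 1 / of_nat p ^ i) = (\<Prod>i = 1..Suc s. 1 - 1 / (of_nat p :: 'a) ^ i)"
    by (simp add: mult.commute)
  finally show ?case .
qed

section \<open>Counting invertible lifts of a residue matrix\<close>

lemma card_residue_class:
  assumes "n > 0" "m dvd n"
  shows "card {x \<in> Zmod n. [x = c] (mod int m)} = n div m"
proof -
  have m: "m > 0" and nm: "n = n div m * m"
    using assms by (auto intro: Nat.gr0I)
  let ?f = "\<lambda>k. int k * int m + c mod int m"
  have "{x \<in> Zmod n. [x = c] (mod int m)} = ?f ` {..<n div m}"
  proof (intro equalityI subsetI)
    fix x assume x: "x \<in> {x \<in> Zmod n. [x = c] (mod int m)}"
    then have "x \<ge> 0" "x < int (n div m) * int m" "x mod int m = c mod int m"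
      using nm by (auto simp: Zmod_def cong_def simp flip: of_nat_mult)
    moreover have "x = x div int m * int m + x mod int m"
      by simp
    moreover have "x div int m \<ge> 0"
      using calculation(1) m by (simp add: pos_imp_zdiv_nonneg_iff)
    moreover have "x div int m < int (n div m)"
    proof (rule ccontr)
      assume "\<not> x div int m < int (n div m)"
      then have "int (n div m) * int m \<le> x div int m * int m"
        by (intro mult_right_mono) auto
      moreover have "x mod int m \<ge> 0"
        using m by simp
      moreover have "x div int m * int m + x mod int m = x"
        by simp
      ultimately show False
        using \<open>x < int (n div m) * int m\<close> by linarith
    qed
    ultimately show "x \<in> ?f ` {..<n div m}"
      by (intro image_eqI[of _ _ "nat (x div int m)"]) auto
  next
    fix x assume "x \<in> ?f ` {..<n div m}"
    then obtain k where k: "k < n div m" "x = ?f k"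
      by auto
    have "c mod int m < int m" "c mod int m \<ge> 0"
      using m by auto
    moreover have "(int k + 1) * int m \<le> int (n div m) * int m"
      using k by (intro mult_right_mono) auto
    ultimately have "x \<ge> 0" "x < int (n div m) * int m"
      using k by (auto simp: algebra_simps)
    moreover have "[x = c] (mod int m)"
      using k by (simp add: cong_def)
    ultimately show "x \<in> {x \<in> Zmod n. [x = c] (mod int m)}"
      using nm by (auto simp: Zmod_def simp flip: of_nat_mult)
  qed
  moreover have "inj_on ?f {..<n div m}"
    using m by (auto intro!: inj_onI)
  ultimately show ?thesis
    by (simp add: card_image)
qed

lemma mat_mod_eq_iff:
  assumes "X \<in> carrier_mat r s" "Y \<in> carrier_mat r s"
  shows "mat_mod n X = mat_mod n Y \<longleftrightarrow> (\<forall>i<r. \<forall>j<s. [X $$ (i, j) = Y $$ (i, j)] (mod int n))"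
  using mat_mod_eqI[OF assms] mat_mod_eqD[OF _ assms] by blast

lemma mat_mod_mult_eq_iff:
  assumes "X \<in> carrier_mat r s" "Y \<in> carrier_mat r s" "coprime m n"
  shows "mat_mod (m * n) X = mat_mod (m * n) Y \<longleftrightarrow>
    mat_mod m X = mat_mod m Y \<and> mat_mod n X = mat_mod n Y"
proof -
  have "[x = y] (mod int (m * n)) \<longleftrightarrow> [x = y] (mod int m) \<and> [x = y] (mod int n)" for x y
    using coprime_cong_mult[of x y "int m" "int n"] assms(3)
    by (auto simp: coprime_int_iff intro: cong_dvd_modulus)
  then show ?thesis
    unfolding mat_mod_eq_iff[OF assms(1,2)] by blast
qed

lemma mat_chinese_remainder:
  assumes "coprime m n"
  obtains W :: "int mat" where "W \<in> carrier_mat r s"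
    "\<And>i j. i < r \<Longrightarrow> j < s \<Longrightarrow> [W $$ (i, j) = Y $$ (i, j)] (mod int m)"
    "\<And>i j. i < r \<Longrightarrow> j < s \<Longrightarrow> [W $$ (i, j) = Z $$ (i, j)] (mod int n)"
proof -
  have "\<forall>p. \<exists>w. [w = Y $$ p] (mod int m) \<and> [w = Z $$ p] (mod int n)"
    using binary_chinese_remainder_int[of "int m" "int n"] assms by (simp add: coprime_int_iff)
  then obtain w where "\<And>p. [w p = Y $$ p] (mod int m) \<and> [w p = Z $$ p] (mod int n)"
    by metis
  then show thesis
    by (intro that[of "mat r s w"]) auto
qed

lemma of_nat_div_eq_divide:
  assumes "m dvd n"
  shows "of_nat (n div m) = (of_nat n / of_nat m :: 'a :: field_char_0)"
proof -
  obtain k where "n = m * k"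
    using assms by blast
  then show ?thesis
    by (cases "m = 0") auto
qed

lemma coprime_prime_int_iff: "prime p \<Longrightarrow> coprime x (int p) \<longleftrightarrow> \<not> int p dvd x"
  using prime_imp_coprime[of "int p" x] coprime_common_divisor[of x "int p" "int p"] prime_gt_1_nat[of p]
  by (auto simp: coprime_commute)

text \<open>Each prime p in Q restricts only X mod p, which the Chinese remainder theorem makes
  independent of X mod m, so p contributes the proportion of matrices mod p that are invertible. The
  induction absorbs p into the modulus, hence m and Y must vary.\<close>

lemma card_lifts_avoiding_primes:
  assumes "finite Q" "n > 0" "\<And>p. p \<in> Q \<Longrightarrow> prime p" "\<And>p. p \<in> Q \<Longrightarrow> \<not> p dvd m"
    "m * \<Prod>Q dvd n" "Y \<in> carrier_mat r r"
  shows "of_nat (card {X \<in> mats_mod r n. mat_mod m X = mat_mod m Y \<and> (\<forall>p\<in>Q. \<not> int p dvd det X)}) =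
    ((of_nat n / of_nat m) ^ (r * r) *
      (\<Prod>p\<in>Q. of_nat (card (GL_Zmod r p)) / of_nat p ^ (r * r)) :: 'a :: field_char_0)"
  using assms
proof (induction Q arbitrary: m Y rule: finite_induct)
  case empty
  have "{X \<in> mats_mod r n. mat_mod m X = mat_mod m Y} =
      mats r (\<lambda>i j. {x \<in> Zmod n. [x = Y $$ (i, j)] (mod int m)})"
    using empty by (auto simp: mats_def mat_mod_eq_iff[where r = r and s = r])
  then have "card {X \<in> mats_mod r n. mat_mod m X = mat_mod m Y} = (n div m) ^ (r * r)"
    using empty by (simp add: card_mats card_residue_class power_mult)
  then show ?case
    using empty by (simp add: of_nat_div_eq_divide)
next
  case (insert p Q)
  let ?S = "{X \<in> mats_mod r n. mat_mod m X = mat_mod m Y \<and> (\<forall>q\<in>insert p Q. \<not> int q dvd det X)}"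
  let ?c = "\<Prod>p\<in>Q. of_nat (card (GL_Zmod r p)) / of_nat p ^ (r * r) :: 'a"
  have p: "prime p" "p > 0"
    using insert.prems prime_gt_0_nat by auto
  have cop: "coprime m p"
    using p(1) insert.prems(3)[of p] prime_imp_coprime[of p m] by (simp add: coprime_commute)
  have m0: "m > 0"
    using insert.prems(1,4) by (auto intro!: Nat.gr0I)
  have dvd: "m * p * \<Prod>Q dvd n"
    using insert.prems(4) insert.hyps by (simp add: mult_ac)
  have fin: "finite ?S"
    by (rule finite_subset[OF _ finite_mats[of r "\<lambda>_ _. Zmod n"]]) auto
  have img: "mat_mod p ` ?S \<subseteq> GL_Zmod r p"
  proof (intro image_subsetI)
    fix X assume "X \<in> ?S"
    then show "mat_mod p X \<in> GL_Zmod r p"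
      using p by (intro mat_mod_GL_Zmod) (auto simp: mats_def coprime_prime_int_iff)
  qed
  have fibre: "of_nat (card {X \<in> ?S. mat_mod p X = Z}) = (of_nat n / of_nat (m * p)) ^ (r * r) * ?c"
    if Z: "Z \<in> GL_Zmod r p" for Z
  proof -
    have Zc: "Z \<in> carrier_mat r r" and Zd: "\<not> int p dvd det Z" and ZZ: "mat_mod p Z = Z"
      using Z p by (auto simp: GL_Zmod_eq mats_def coprime_prime_int_iff mat_mod_id)
    \<comment> \<open>Prescribing X mod p as Z, besides X mod m as Y, is the single condition that X
      agree with W modulo \<open>m * p\<close>. To this the induction hypothesis applies.\<close>
    obtain W where W: "W \<in> carrier_mat r r"
      "\<And>i j. i < r \<Longrightarrow> j < r \<Longrightarrow> [W $$ (i, j) = Y $$ (i, j)] (mod int m)"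
      "\<And>i j. i < r \<Longrightarrow> j < r \<Longrightarrow> [W $$ (i, j) = Z $$ (i, j)] (mod int p)"
      using mat_chinese_remainder[OF cop, of r r Y Z] by metis
    have WY: "mat_mod m W = mat_mod m Y"
      using W(1,2) insert.prems(5) by (intro mat_mod_eqI[of _ r r]) auto
    have "mat_mod p W = mat_mod p Z"
      using W(1,3) Zc by (intro mat_mod_eqI[of _ r r]) auto
    then have WZ: "mat_mod p W = Z"
      by (simp add: ZZ)
    have "{X \<in> ?S. mat_mod p X = Z} =
        {X \<in> mats_mod r n. mat_mod (m * p) X = mat_mod (m * p) W \<and> (\<forall>q\<in>Q. \<not> int q dvd det X)}"
    proof -
      have "mat_mod (m * p) X = mat_mod (m * p) W \<longleftrightarrow> mat_mod m X = mat_mod m Y \<and> mat_mod p X = Z"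
        if "X \<in> mats_mod r n" for X
        using mat_mod_mult_eq_iff[of X r r W m p] that W(1) cop WY WZ by (simp add: mats_def)
      moreover have "\<not> int p dvd det X" if "X \<in> mats_mod r n" "mat_mod p X = Z" for X
        using cong_dvd_iff[OF det_mat_mod[of X r p]] that Zd by (simp add: mats_def)
      ultimately show ?thesis
        by blast
    qed
    moreover have "\<not> q dvd m * p" if "q \<in> Q" for q
      using that insert.prems(2,3)[of q] insert.hyps(2) p(1) primes_dvd_imp_eq[of q p]
      by (auto simp: prime_dvd_mult_iff)
    ultimately show ?thesis
      using insert.IH[of "m * p" W] insert.prems(1,2) dvd W(1) by simp
  qed
  have "card ?S = (\<Sum>Z\<in>GL_Zmod r p. card {X \<in> ?S. mat_mod p X = Z})"
    using sum.group[OF fin finite_GL_Zmod[OF p(2)] img, of "\<lambda>_. 1 :: nat"] by simp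
  then have "of_nat (card ?S) = (\<Sum>Z\<in>GL_Zmod r p. (of_nat n / of_nat (m * p)) ^ (r * r) * ?c)"
    using fibre by simp
  also have "\<dots> = (of_nat n / of_nat m) ^ (r * r) * (of_nat (card (GL_Zmod r p)) / of_nat p ^ (r * r) * ?c)"
    using m0 p(2) by (simp add: power_mult_distrib power_divide)
  finally show ?case
    using insert.hyps by simp
qed

text \<open>Distinct primes not dividing m are coprime to one another and to m, so divisibility of n
  by each factor gives divisibility by the product.\<close>

lemma prod_primes_dvd:
  fixes n :: nat
  assumes "finite Q" "\<And>p. p \<in> Q \<Longrightarrow> prime p \<and> p dvd n \<and> \<not> p dvd m" "m dvd n"
  shows "m * \<Prod>Q dvd n"
  using assms
proof (induction Q rule: finite_induct)
  case (insert p Q)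
  have "coprime p (m * \<Prod>Q)"
  proof (rule prime_imp_coprime)
    show "prime p" using insert.prems by blast
    have "\<not> p dvd \<Prod>Q"
    proof
      assume "p dvd \<Prod>Q"
      then obtain q where "q \<in> Q" "p dvd q"
        using insert.prems insert.hyps(1) prime_dvd_prod_iff[of Q p "\<lambda>x. x"] by auto
      then show False
        using insert.prems insert.hyps(2) primes_dvd_imp_eq[of p q] by auto
    qed
    then show "\<not> p dvd m * \<Prod>Q"
      using insert.prems by (simp add: prime_dvd_mult_iff)
  qed
  then have "p * (m * \<Prod>Q) dvd n"
  proof (rule divides_mult[rotated 2])
    show "m * \<Prod>Q dvd n"
      using insert by blast
  qed (use insert.prems in auto)
  then show ?case
    using insert.hyps by (simp add: mult_ac)
qed simp

text \<open>Allows coprimality to n to be tested separately at the primes dividing m and at the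
  others.\<close>

lemma coprime_int_iff_primes:
  assumes "n > 0"
  shows "coprime x (int n) \<longleftrightarrow> (\<forall>p. prime p \<and> p dvd n \<longrightarrow> \<not> int p dvd x)"
proof
  assume "coprime x (int n)"
  then have "p = 1" if "p dvd n" "int p dvd x" for p
    using coprime_common_divisor[of x "int n" "int p"] that by simp
  then show "\<forall>p. prime p \<and> p dvd n \<longrightarrow> \<not> int p dvd x"
    using not_prime_1 by blast
next
  assume *: "\<forall>p. prime p \<and> p dvd n \<longrightarrow> \<not> int p dvd x"
  show "coprime x (int n)"
  proof (rule ccontr)
    assume "\<not> coprime x (int n)"
    then have "nat (gcd x (int n)) \<noteq> 1"
      by (auto simp: coprime_iff_gcd_eq_1)
    then obtain p where p: "prime p" "p dvd nat (gcd x (int n))"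
      using prime_factor_nat by blast
    then have "int p dvd gcd x (int n)"
      using int_dvd_int_iff[of p "nat (gcd x (int n))"] by simp
    with p * show False
      by auto
  qed
qed

text \<open>At the primes dividing m, invertibility of X is inherited from Y. Only the primes of n
  outside m restrict the choice of lift, and the count does not depend on Y.\<close>

lemma card_GL_fibre:
  assumes "n > 0" "m dvd n" "Y \<in> GL_Zmod r m"
  shows "of_nat (card {X \<in> GL_Zmod r n. mat_mod m X = Y}) =
    (of_nat (n div m) ^ (r * r) *
      (\<Prod>p\<in>{p. prime p \<and> p dvd n \<and> \<not> p dvd m}. \<Prod>i = 1..r. 1 - 1 / of_nat p ^ i) :: 'a :: field_char_0)"
proof -
  let ?Q = "{p. prime p \<and> p dvd n \<and> \<not> p dvd m}"
  have m: "m > 0"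
    using assms by (auto intro: Nat.gr0I)
  have fin: "finite ?Q"
    using assms(1) by (intro finite_subset[OF _ finite_divisors_nat[of n]]) auto
  have dvd: "m * \<Prod>?Q dvd n"
    using fin assms(2) by (intro prod_primes_dvd) auto
  have Y: "Y \<in> carrier_mat r r" "mat_mod m Y = Y" "coprime (det Y) (int m)"
    using assms(3) m by (auto simp: GL_Zmod_eq mat_mod_id mats_def)
  have "coprime (det X) (int n) \<longleftrightarrow> (\<forall>p\<in>?Q. \<not> int p dvd det X)"
    if X: "X \<in> carrier_mat r r" "mat_mod m X = Y" for X
  proof -
    have "coprime (det X) (int m)"
      using cong_imp_coprime[OF det_mat_mod[OF X(1), of m]] X(2) Y(3) by simp
    then show ?thesis
      using coprime_int_iff_primes[OF m] coprime_int_iff_primes[OF assms(1)] by blast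
  qed
  then have eq: "{X \<in> GL_Zmod r n. mat_mod m X = Y} =
      {X \<in> mats_mod r n. mat_mod m X = mat_mod m Y \<and> (\<forall>p\<in>?Q. \<not> int p dvd det X)}"
    using assms(1) Y(2) by (auto simp: GL_Zmod_eq mats_def)
  have "of_nat (card {X \<in> GL_Zmod r n. mat_mod m X = Y}) = (of_nat n / of_nat m) ^ (r * r) *
      (\<Prod>p\<in>?Q. of_nat (card (GL_Zmod r p)) / of_nat p ^ (r * r) :: 'a)"
    unfolding eq by (rule card_lifts_avoiding_primes[OF fin assms(1) _ _ dvd Y(1)]) auto
  also have "(\<Prod>p\<in>?Q. of_nat (card (GL_Zmod r p)) / of_nat p ^ (r * r) :: 'a) =
      (\<Prod>p\<in>?Q. \<Prod>i = 1..r. 1 - 1 / of_nat p ^ i)"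
  proof (rule prod.cong)
    fix p assume "p \<in> ?Q"
    then have p: "prime p" "(of_nat p :: 'a) ^ (r * r) \<noteq> 0"
      using prime_gt_0_nat[of p] by auto
    show "of_nat (card (GL_Zmod r p)) / of_nat p ^ (r * r) = (\<Prod>i = 1..r. 1 - 1 / (of_nat p :: 'a) ^ i)"
      unfolding card_GL_prime[OF p(1)] using p(2) by (rule nonzero_mult_div_cancel_left)
  qed simp
  also have "of_nat n / of_nat m = (of_nat (n div m) :: 'a)"
    using assms(2) by (simp add: of_nat_div_eq_divide)
  finally show ?thesis .
qed

section \<open>Additive characters and their orthogonality\<close>

lemma add_char_add: "add_char m b (x + y) = add_char m b x * add_char m b y"
  by (simp add: add_char_def ring_distribs add_divide_distrib exp_add)

lemma add_char_0 [simp]: "add_char m b 0 = 1"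
  by (simp add: add_char_def)

lemma add_char_sum: "add_char m b (\<Sum>i\<in>I. g i) = (\<Prod>i\<in>I. add_char m b (g i))"
  by (induction I rule: infinite_finite_induct) (simp_all add: add_char_add)

text \<open>The value is the point of the unit circle at angle 2 pi b x / m, which is 1 exactly when
  b x / m is an integer.\<close>

lemma add_char_eq_1_iff:
  assumes "m > 0"
  shows "add_char m b x = 1 \<longleftrightarrow> int m dvd b * x"
proof -
  \<comment> \<open>On the unit circle cos t = 1 forces sin t = 0, which reduces the question to the
    real cosine.\<close>
  have "cis t = 1 \<longleftrightarrow> cos t = 1" for t
    using cos_one_sin_zero[of t] by (auto simp: complex_eq_iff)
  moreover have "add_char m b x = cis (2 * pi * real_of_int (b * x) / real m)"
    by (simp add: add_char_def cis_conv_exp mult_ac)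
  ultimately have "add_char m b x = 1 \<longleftrightarrow>
      (\<exists>k::int. 2 * pi * real_of_int (b * x) / real m = real_of_int k * 2 * pi)"
    by (simp only: cos_one_2pi_int)
  also have "\<dots> \<longleftrightarrow> (\<exists>k::int. real_of_int (b * x) = real_of_int (int m * k))"
    using assms by (simp add: field_simps)
  also have "\<dots> \<longleftrightarrow> int m dvd b * x"
    unfolding of_int_eq_iff by (auto simp: dvd_def)
  finally show ?thesis .
qed

lemma add_char_cong:
  assumes "m > 0" "[x = y] (mod int m)"
  shows "add_char m b x = add_char m b y"
proof -
  have "int m dvd b * (x - y)"
    using assms(2) by (simp add: cong_iff_dvd_diff)
  then have "add_char m b (x - y) = 1"
    using assms(1) by (simp add: add_char_eq_1_iff)
  then show ?thesis
    using add_char_add[of m b "x - y" y] by simp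
qed

text \<open>Orthogonality: shifting u by 1 multiplies the sum by \<open>add_char m b x\<close>,
  which differs from 1 unless m divides x, because b is a unit mod m. The range is
  \<open>Zmod n\<close> since u will be an entry of a matrix over Z_n; as m divides n, reducing the
  shift mod n is harmless.\<close>

lemma sum_add_char:
  assumes "m > 0" "m dvd n" "n > 0" "coprime b (int m)"
  shows "(\<Sum>u\<in>Zmod n. add_char m b (u * x)) = (if int m dvd x then of_nat n else 0)"
proof (cases "int m dvd x")
  case True
  then have "add_char m b (u * x) = 1" for u
    using assms(1) by (simp add: add_char_eq_1_iff)
  with True show ?thesis
    by simp
next
  case False
  then have ne: "add_char m b x \<noteq> 1"
    using assms by (simp add: add_char_eq_1_iff coprime_dvd_mult_right_iff coprime_commute)
  have inj: "inj_on (\<lambda>u. (u + 1) mod int n) (Zmod n)"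
  proof (rule inj_onI)
    fix u v assume uv: "u \<in> Zmod n" "v \<in> Zmod n" "(u + 1) mod int n = (v + 1) mod int n"
    then have "[u + 1 = v + 1] (mod int n)"
      by (simp add: cong_def)
    then have "[u = v] (mod int n)"
      by (simp only: cong_add_rcancel)
    then show "u = v"
      using uv by (simp add: cong_def Zmod_mod_eq)
  qed
  have "(\<lambda>u. (u + 1) mod int n) ` Zmod n \<subseteq> Zmod n"
    using assms(3) by auto
  then have bij: "bij_betw (\<lambda>u. (u + 1) mod int n) (Zmod n) (Zmod n)"
    using inj endo_inj_surj[OF finite_Zmod] by (simp add: bij_betw_def)
  have "(\<Sum>u\<in>Zmod n. add_char m b (u * x)) = (\<Sum>u\<in>Zmod n. add_char m b ((u + 1) mod int n * x))"
    by (rule sum.reindex_bij_betw[OF bij, symmetric])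
  also have "\<dots> = (\<Sum>u\<in>Zmod n. add_char m b (u * x) * add_char m b x)"
  proof (rule sum.cong)
    fix u
    have "[(u + 1) mod int n = u + 1] (mod int m)"
      using assms(2) by (simp add: cong_def mod_mod_cancel)
    then have "[(u + 1) mod int n * x = (u + 1) * x] (mod int m)"
      by (rule cong_scalar_right)
    then have "add_char m b ((u + 1) mod int n * x) = add_char m b (u * x + x)"
      using add_char_cong[OF assms(1)] by (simp add: ring_distribs)
    then show "add_char m b ((u + 1) mod int n * x) = add_char m b (u * x) * add_char m b x"
      by (simp add: add_char_add)
  qed simp
  also have "\<dots> = (\<Sum>u\<in>Zmod n. add_char m b (u * x)) * add_char m b x"
    by (simp add: sum_distrib_right)
  finally show ?thesis
    using ne False by simp
qed

section \<open>Lifting units, and divisibility by the conductor\<close>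

lemma coprime_dvd_trans: "coprime x (int n) \<Longrightarrow> m dvd n \<Longrightarrow> coprime x (int m)"
  using coprime_divisors[of x x "int m" "int n"] by simp

text \<open>Keep the class of x mod m and prescribe the class 1 modulo every prime of n that does
  not divide m. Then no prime of n divides the resulting integer.\<close>

lemma unit_lift:
  assumes "n > 0" "m dvd n" "coprime x (int m)"
  obtains y where "coprime y (int n)" "[y = x] (mod int m)"
proof -
  let ?Q = "{p. prime p \<and> p dvd n \<and> \<not> p dvd m}"
  have m: "m > 0"
    using assms by (auto intro: Nat.gr0I)
  have fin: "finite ?Q"
    using assms(1) by (intro finite_subset[OF _ finite_divisors_nat[of n]]) auto
  have "coprime m (\<Prod>?Q)"
  proof (rule prod_coprime_right)
    fix p assume "p \<in> ?Q"
    then show "coprime m p"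
      using prime_imp_coprime[of p m] by (simp add: coprime_commute)
  qed
  then have "coprime (int m) (int (\<Prod>?Q))"
    unfolding coprime_int_iff .
  then obtain y where y: "[y = x] (mod int m)" "[y = 1] (mod int (\<Prod>?Q))"
    using binary_chinese_remainder_int[of "int m" "int (\<Prod>?Q)" x 1] by blast
  have "\<not> int p dvd y" if p: "prime p" "p dvd n" for p
  proof (cases "p dvd m")
    case True
    have "coprime y (int m)"
      using cong_imp_coprime[OF cong_sym[OF y(1)]] assms(3) by simp
    then show ?thesis
      using coprime_int_iff_primes[OF m] p True by blast
  next
    case False
    then have "p dvd \<Prod>?Q"
      using p fin by (intro dvd_prodI) auto
    then have "[y = 1] (mod int p)"
      using y(2) by (meson cong_dvd_modulus int_dvd_int_iff)
    then have "int p dvd y \<longleftrightarrow> int p dvd 1"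
      by (rule cong_dvd_iff)
    then show ?thesis
      using prime_gt_1_nat[OF p(1)] by simp
  qed
  then have "coprime y (int n)"
    using coprime_int_iff_primes[OF assms(1)] by blast
  with y(1) show thesis
    using that by blast
qed

lemma mult_character_mult:
  assumes "n > 0" "mult_character n \<chi>" "coprime x (int n)" "coprime y (int n)"
  shows "\<chi> (x * y mod int n) = \<chi> (x mod int n) * \<chi> (y mod int n)"
proof -
  have "\<chi> (x mod int n * (y mod int n) mod int n) = \<chi> (x mod int n) * \<chi> (y mod int n)"
    using assms by (simp add: mult_character_def mod_in_Zmod_units)
  then show ?thesis
    by (simp add: mod_mult_eq)
qed

text \<open>Frees the condition from least residues, so that it applies directly to integers
  obtained from Bezout identities and the Chinese remainder theorem.\<close>

lemma factors_through_iff: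
  assumes "n > 0" "f dvd n"
  shows "factors_through n \<chi> f \<longleftrightarrow>
    (\<forall>c. coprime c (int n) \<and> [c = 1] (mod int f) \<longrightarrow> \<chi> (c mod int n) = 1)"
proof -
  have *: "[c mod int n = 1] (mod int f) \<longleftrightarrow> [c = 1] (mod int f)" for c
    using assms(2) by (simp add: cong_def mod_mod_cancel)
  show ?thesis
  proof
    assume "factors_through n \<chi> f"
    then show "\<forall>c. coprime c (int n) \<and> [c = 1] (mod int f) \<longrightarrow> \<chi> (c mod int n) = 1"
      using assms(1) * by (auto simp: factors_through_def mod_in_Zmod_units)
  next
    assume c: "\<forall>c. coprime c (int n) \<and> [c = 1] (mod int f) \<longrightarrow> \<chi> (c mod int n) = 1"
    have "\<chi> c = 1" if "c \<in> Zmod_units n" "[c = 1] (mod int f)" for c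
      using c[rule_format, of c] that assms(1) by (simp add: Zmod_units_iff)
    then show "factors_through n \<chi> f"
      using assms(2) by (simp add: factors_through_def)
  qed
qed

text \<open>
  A unit congruent to 1 modulo the gcd is a product of units congruent to 1 modulo \<open>f\<close> and modulo \<open>m\<close>.
  This is why the least \<open>f\<close> through which \<open>\<chi>\<close> factors divides all the others.
\<close>
lemma factors_through_gcd:
  assumes "n > 0" "mult_character n \<chi>" "factors_through n \<chi> f" "factors_through n \<chi> m"
  shows "factors_through n \<chi> (gcd f m)"
proof -
  have fn: "f dvd n" and mn: "m dvd n"
    using assms by (simp_all add: factors_through_def)
  then have gn: "gcd f m dvd n" and ln: "lcm f m dvd n"
    by (auto intro: dvd_trans[OF gcd_dvd1])
  have "\<chi> (c mod int n) = 1" if c: "coprime c (int n)" "[c = 1] (mod int (gcd f m))" for c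
  proof -
    obtain k where "c - 1 = int (gcd f m) * k"
      using c(2) by (auto simp: cong_iff_dvd_diff)
    then have "c - 1 = gcd (int f) (int m) * k"
      by simp
    moreover obtain u v where "u * int f + v * int m = gcd (int f) (int m)"
      using bezout_int by blast
    ultimately have uv: "c - 1 = k * u * int f + k * v * int m"
      by (simp add: algebra_simps flip: distrib_left)
    \<comment> \<open>Bezout writes c - 1 as a multiple of f plus a multiple of m. Keeping only the
      first part gives 1 mod f and c mod m.\<close>
    define x where "x = 1 + k * u * int f"
    have xf: "[x = 1] (mod int f)"
      by (simp add: x_def cong_iff_dvd_diff)
    have "c = x + k * v * int m"
      using uv by (simp add: x_def)
    then have xm: "[x = c] (mod int m)"
      by (simp add: cong_iff_dvd_diff)
    have "coprime x (int f)"
      using cong_imp_coprime[OF cong_sym[OF xf]] by simp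
    moreover have "coprime x (int m)"
      using cong_imp_coprime[OF cong_sym[OF xm]] coprime_dvd_trans[OF c(1) mn] by simp
    ultimately have "coprime x (int f * int m)"
      by simp
    moreover have "int (lcm f m) dvd int f * int m"
      by (metis int_dvd_int_iff lcm_least dvd_triv_left dvd_triv_right of_nat_mult)
    ultimately have "coprime x (int (lcm f m))"
      using coprime_divisors[of x x "int (lcm f m)" "int f * int m"] by simp
    \<comment> \<open>So far x is known to be coprime to f and m only. It is replaced by a unit
      modulo n in the same class modulo the lcm, hence in the same classes modulo f and m.\<close>
    then obtain y where y: "coprime y (int n)" "[y = x] (mod int (lcm f m))"
      using unit_lift[OF assms(1) ln] by blast
    have yf: "[y = 1] (mod int f)"
      using cong_trans[OF cong_dvd_modulus[OF y(2)] xf] by simp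
    have ym: "[y = c] (mod int m)"
      using cong_trans[OF cong_dvd_modulus[OF y(2)] xm] by simp
    obtain w where w: "[y * w = 1] (mod int n)"
      using y(1) by (auto simp: coprime_iff_invertible_int)
    have wc: "coprime w (int n)"
      using w by (auto simp: coprime_iff_invertible_int mult.commute)
    have "[y * w = c * w] (mod int m)"
      using ym by (rule cong_scalar_right)
    moreover have "[y * w = 1] (mod int m)"
      using cong_dvd_modulus[OF w] mn by simp
    ultimately have cw: "[c * w = 1] (mod int m)"
      using cong_sym cong_trans by blast
    \<comment> \<open>The two factors of c are y, which is 1 mod f, and \<open>c * w\<close>, which
      is 1 mod m.\<close>
    have "[y * (c * w) = c * 1] (mod int n)"
      using cong_scalar_left[OF w, of c] by (simp add: mult_ac)
    then have "c mod int n = y * (c * w) mod int n"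
      by (simp add: cong_def)
    then have "\<chi> (c mod int n) = \<chi> (y mod int n) * \<chi> (c * w mod int n)"
      using mult_character_mult[OF assms(1,2) y(1), of "c * w"] c(1) wc by simp
    also have "\<dots> = 1"
      using assms yf cw c(1) wc y(1) by (simp add: factors_through_iff fn mn)
    finally show ?thesis .
  qed
  then show ?thesis
    using factors_through_iff[OF assms(1) gn] by blast
qed

text \<open>\<chi> factors through the gcd of the conductor and m, so minimality forces this gcd to
  be the conductor itself.\<close>

lemma conductor_dvd:
  assumes "n > 0" "mult_character n \<chi>" "factors_through n \<chi> m"
  shows "conductor n \<chi> dvd m"
proof -
  let ?f = "conductor n \<chi>"
  have f: "?f > 0" "factors_through n \<chi> ?f"
    using conductor_props[OF assms(1,2)] by auto
  have "gcd ?f m > 0 \<and> factors_through n \<chi> (gcd ?f m)"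
    using f factors_through_gcd[OF assms(1,2) f(2) assms(3)] by simp
  then have "?f \<le> gcd ?f m"
    unfolding conductor_def by (rule Least_le)
  then have "gcd ?f m = ?f"
    using gcd_le1_nat[of ?f m] f(1) by linarith
  then show ?thesis
    by (metis gcd_dvd2)
qed

section \<open>Translating and averaging the matrix Gauss sum\<close>

lemma add_char_cancel:
  assumes "d > 0"
  shows "add_char (d * m) (int d * b) = add_char m b"
  using assms by (simp add: fun_eq_iff add_char_def mult_ac)

lemma mat_trace_mult:
  assumes "U \<in> carrier_mat r r" "X \<in> carrier_mat r r"
  shows "mat_trace (U * X) = (\<Sum>i<r. \<Sum>j<r. U $$ (i, j) * X $$ (j, i))"
  using assms
  by (simp add: mat_trace_def index_mult_mat_sum[where r = r and s = r and t = r] del: index_mult_mat(1))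

lemma add_char_mod: "m > 0 \<Longrightarrow> m dvd n \<Longrightarrow> add_char m b (x mod int n) = add_char m b x"
  by (intro add_char_cong) (simp_all add: cong_def mod_mod_cancel)

text \<open>Substitute U X, reduced mod n, for X. The reduction is invisible to \<chi>(det), and to
  the additive character as well, since the latter reads the trace only mod m and m divides
  n.\<close>

lemma GL_sum_mult_left:
  assumes n: "n > 0" and m: "m > 0" "m dvd n" and \<chi>: "mult_character n \<chi>"
    and U: "U \<in> carrier_mat r r" "coprime (det U) (int n)"
  shows "(\<Sum>X\<in>GL_Zmod r n. \<chi> (det X mod int n) * add_char m b (mat_trace X)) =
    \<chi> (det U mod int n) * (\<Sum>X\<in>GL_Zmod r n. \<chi> (det X mod int n) * add_char m b (mat_trace (U * X)))"
proof -
  let ?f = "\<lambda>X. mat_mod n (U * X)"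
  have "(\<Sum>X\<in>GL_Zmod r n. \<chi> (det X mod int n) * add_char m b (mat_trace X)) =
    (\<Sum>X\<in>GL_Zmod r n. \<chi> (det (?f X) mod int n) * add_char m b (mat_trace (?f X)))"
    by (rule sum.reindex_bij_betw[OF bij_betw_mult_GL[OF n U], symmetric])
  also have "\<dots> = (\<Sum>X\<in>GL_Zmod r n. \<chi> (det U mod int n) *
      (\<chi> (det X mod int n) * add_char m b (mat_trace (U * X))))"
  proof (rule sum.cong)
    fix X assume X: "X \<in> GL_Zmod r n"
    then have Xc: "X \<in> carrier_mat r r" "coprime (det X) (int n)"
      using n by (auto simp: GL_Zmod_eq mats_def)
    have UX: "U * X \<in> carrier_mat r r"
      using U Xc by simp
    have "det (?f X) mod int n = det U * det X mod int n"
      using det_mat_mod[OF UX, of n] det_mult[OF U(1) Xc(1)] by (simp add: cong_def)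
    then have "\<chi> (det (?f X) mod int n) = \<chi> (det U mod int n) * \<chi> (det X mod int n)"
      using mult_character_mult[OF n \<chi> U(2) Xc(2)] by simp
    moreover have "[mat_trace (?f X) = mat_trace (U * X)] (mod int m)"
      using cong_dvd_modulus[OF mat_trace_mat_mod[OF UX]] m by simp
    then have "add_char m b (mat_trace (?f X)) = add_char m b (mat_trace (U * X))"
      by (rule add_char_cong[OF m(1)])
    ultimately show "\<chi> (det (?f X) mod int n) * add_char m b (mat_trace (?f X)) =
        \<chi> (det U mod int n) * (\<chi> (det X mod int n) * add_char m b (mat_trace (U * X)))"
      by simp
  qed simp
  finally show ?thesis
    by (simp add: sum_distrib_left)
qed

text \<open>Scaling row 0 by c leaves the trace unchanged mod m because c = 1 mod m. The rank must
  be positive for such a row to exist; for r = 0 the sum is 1.\<close>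

lemma GL_sum_eq_0:
  assumes n: "n > 0" and m: "m > 0" "m dvd n" and \<chi>: "mult_character n \<chi>" and "r > 0"
    and "\<not> factors_through n \<chi> m"
  shows "(\<Sum>X\<in>GL_Zmod r n. \<chi> (det X mod int n) * add_char m b (mat_trace X)) = 0"
proof -
  let ?S = "\<Sum>X\<in>GL_Zmod r n. \<chi> (det X mod int n) * add_char m b (mat_trace X)"
  obtain c where c: "coprime c (int n)" "[c = 1] (mod int m)" "\<chi> (c mod int n) \<noteq> 1"
    using assms(6) factors_through_iff[OF n m(2)] by blast
  define U where "U = mat r r (\<lambda>(i, j). if i = j then if i = 0 then c else 1 else 0)"
  have U: "U \<in> carrier_mat r r"
    by (simp add: U_def)
  obtain s where s: "r = Suc s"
    using assms(5) by (cases r) auto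
  have "det U = prod_list (diag_mat U)"
    using U by (intro det_lower_triangular[of r]) (auto simp: U_def)
  also have "\<dots> = c"
    by (simp add: prod_list_diag_prod U_def s prod.atLeast0_lessThan_Suc_shift del: prod.op_ivl_Suc)
  finally have det: "det U = c" .
  have tr: "add_char m b (mat_trace (U * X)) = add_char m b (mat_trace X)" if X: "X \<in> GL_Zmod r n" for X
  proof (rule add_char_cong[OF m(1)])
    have Xc: "X \<in> carrier_mat r r"
      using X by (rule GL_Zmod_carrier)
    have "(\<Sum>j<r. U $$ (i, j) * X $$ (j, i)) = (if i = 0 then c else 1) * X $$ (i, i)" if "i < r" for i
    proof -
      have "(\<Sum>j<r. U $$ (i, j) * X $$ (j, i)) =
          (\<Sum>j<r. if j = i then (if i = 0 then c else 1) * X $$ (i, i) else 0)"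
        using that by (intro sum.cong) (auto simp: U_def)
      then show ?thesis
        using that by simp
    qed
    then have "mat_trace (U * X) = (\<Sum>i<r. (if i = 0 then c else 1) * X $$ (i, i))"
      by (simp add: mat_trace_mult[OF U Xc])
    also have "[\<dots> = (\<Sum>i<r. 1 * X $$ (i, i))] (mod int m)"
      using c(2) by (intro cong_sum cong_mult) auto
    also have "(\<Sum>i<r. 1 * X $$ (i, i)) = mat_trace X"
      using Xc by (simp add: mat_trace_def)
    finally show "[mat_trace (U * X) = mat_trace X] (mod int m)" .
  qed
  have "?S = \<chi> (c mod int n) * (\<Sum>X\<in>GL_Zmod r n. \<chi> (det X mod int n) * add_char m b (mat_trace (U * X)))"
    using GL_sum_mult_left[OF n m \<chi> U, of b] c(1) det by simp
  also have "\<dots> = \<chi> (c mod int n) * ?S"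
    using tr by simp
  finally have "(\<chi> (c mod int n) - 1) * ?S = 0"
    by (simp add: left_diff_distrib)
  then show ?thesis
    using c(3) by simp
qed

text \<open>The indices are transposed to match the products
  \<open>U $$ (i, j) * X $$ (j, i)\<close> in the trace: i < j marks a position where the
  unitriangular U is free.\<close>

definition upper_triangular_mod :: "nat \<Rightarrow> nat \<Rightarrow> int mat \<Rightarrow> bool" where
  "upper_triangular_mod r m X \<longleftrightarrow> (\<forall>i<r. \<forall>j<r. i < j \<longrightarrow> int m dvd X $$ (j, i))"

lemma prod_diagonal:
  fixes g :: "nat \<Rightarrow> 'a :: comm_monoid_mult"
  assumes "\<And>i j. i < r \<Longrightarrow> j < r \<Longrightarrow> i \<noteq> j \<Longrightarrow> h i j = 1" "\<And>i. i < r \<Longrightarrow> h i i = g i"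
  shows "(\<Prod>i<r. \<Prod>j<r. h i j) = (\<Prod>i<r. g i)"
proof (rule prod.cong)
  fix i assume i: "i \<in> {..<r}"
  then have "(\<Prod>j<r. h i j) = (\<Prod>j<r. if j = i then g i else 1)"
    using assms by (intro prod.cong) auto
  with i show "(\<Prod>j<r. h i j) = g i"
    by simp
qed simp

text \<open>In the trace of \<open>U * X\<close> each entry of U meets exactly one entry of X, so
  the sum splits over the positions of U. A free entry gives an orthogonality sum that tests
  divisibility of \<open>X $$ (j, i)\<close> by m, and the diagonal ones give the trace of
  X.\<close>

lemma sum_unipotent_add_char:
  assumes n: "n > 0" and m: "m > 0" "m dvd n" "coprime b (int m)" and X: "X \<in> carrier_mat r r"
  defines "A \<equiv> \<lambda>i j. if i = j then {1} else if i < j then Zmod n else {0}"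
  shows "(\<Sum>U\<in>mats r A. add_char m b (mat_trace (U * X))) =
    of_nat (card (mats r A)) * (if upper_triangular_mod r m X then add_char m b (mat_trace X) else 0)"
proof -
  \<comment> \<open>What position (i, j) contributes once the number of choices
    \<open>card (A i j)\<close> has been pulled out.\<close>
  let ?w = "\<lambda>i j. if i = j then add_char m b (X $$ (i, i))
    else if i < j \<and> \<not> int m dvd X $$ (j, i) then 0 else 1"
  have fin: "finite (A i j)" for i j
    by (simp add: A_def)
  have "(\<Sum>U\<in>mats r A. add_char m b (mat_trace (U * X))) =
      (\<Sum>U\<in>mats r A. \<Prod>i<r. \<Prod>j<r. add_char m b (U $$ (i, j) * X $$ (j, i)))"
  proof (rule sum.cong)
    fix U assume "U \<in> mats r A"
    then have U: "U \<in> carrier_mat r r"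
      by (simp add: mats_def)
    show "add_char m b (mat_trace (U * X)) = (\<Prod>i<r. \<Prod>j<r. add_char m b (U $$ (i, j) * X $$ (j, i)))"
      by (simp add: mat_trace_mult[OF U X] add_char_sum)
  qed simp
  also have "\<dots> = (\<Prod>i<r. \<Prod>j<r. \<Sum>u\<in>A i j. add_char m b (u * X $$ (j, i)))"
    by (rule sum_prod_mats) (rule fin)
  also have "\<dots> = (\<Prod>i<r. \<Prod>j<r. of_nat (card (A i j)) * ?w i j)"
    using sum_add_char[OF m(1,2) n m(3)] by (intro prod.cong refl) (simp add: A_def)
  also have "\<dots> = of_nat (card (mats r A)) * (\<Prod>i<r. \<Prod>j<r. ?w i j)"
    by (simp add: card_mats[OF fin] prod.distrib)
  also have "(\<Prod>i<r. \<Prod>j<r. ?w i j) =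
      (if upper_triangular_mod r m X then add_char m b (mat_trace X) else 0)"
  proof (cases "upper_triangular_mod r m X")
    case True
    then have "(\<Prod>i<r. \<Prod>j<r. ?w i j) = (\<Prod>i<r. add_char m b (X $$ (i, i)))"
      by (intro prod_diagonal) (auto simp: upper_triangular_mod_def)
    with True show ?thesis
      using X by (simp add: mat_trace_def add_char_sum)
  next
    case False
    then obtain i j where "i < r" "j < r" "i < j" "\<not> int m dvd X $$ (j, i)"
      by (auto simp: upper_triangular_mod_def)
    then have "\<exists>i\<in>{..<r}. (\<Prod>j<r. ?w i j) = 0"
      by (intro bexI[of _ i]) (auto intro!: bexI[of _ j])
    with False show ?thesis
      by (simp add: prod_zero_iff)
  qed
  finally show ?thesis .
qed

lemma GL_sum_upper_triangular:
  assumes n: "n > 0" and m: "m > 0" "m dvd n" "coprime b (int m)" and \<chi>: "mult_character n \<chi>"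
  shows "(\<Sum>X\<in>GL_Zmod r n. \<chi> (det X mod int n) * add_char m b (mat_trace X)) =
    (\<Sum>X\<in>{X \<in> GL_Zmod r n. upper_triangular_mod r m X}. \<chi> (det X mod int n) * add_char m b (mat_trace X))"
proof -
  let ?S = "\<Sum>X\<in>GL_Zmod r n. \<chi> (det X mod int n) * add_char m b (mat_trace X)"
  let ?T = "\<Sum>X\<in>{X \<in> GL_Zmod r n. upper_triangular_mod r m X}. \<chi> (det X mod int n) * add_char m b (mat_trace X)"
  define A where "A = (\<lambda>(i :: nat) j. if i = j then {1} else if i < j then Zmod n else {0 :: int})"
  have fin: "finite (A i j)" for i j
    by (simp add: A_def)
  have eq: "?S = (\<Sum>X\<in>GL_Zmod r n. \<chi> (det X mod int n) * add_char m b (mat_trace (U * X)))"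
    if U: "U \<in> mats r A" for U
  proof -
    have Uc: "U \<in> carrier_mat r r" and UA: "\<And>i j. i < r \<Longrightarrow> j < r \<Longrightarrow> U $$ (i, j) \<in> A i j"
      using U by (auto simp: mats_def)
    have "U $$ (i, j) = 0" if "i < r" "j < i" for i j
      using UA[of i j] that by (simp add: A_def)
    then have "det U = prod_list (diag_mat U)"
      using Uc by (intro det_upper_triangular[of _ r]) auto
    also have "\<dots> = (\<Prod>i = 0..<r. 1)"
      unfolding prod_list_diag_prod
    proof (rule prod.cong)
      fix i assume "i \<in> {0..<r}"
      then show "U $$ (i, i) = 1"
        using UA[of i i] by (simp add: A_def)
    qed (use Uc in simp)
    finally have "det U = 1" by simp
    then show ?thesis
      using GL_sum_mult_left[OF n m(1,2) \<chi> Uc, of b] mult_character_one[OF n \<chi>] by simp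
  qed
  \<comment> \<open>The average is taken without division: both sides acquire the number of
    unitriangular matrices, which is nonzero and is cancelled at the end.\<close>
  have "of_nat (card (mats r A)) * ?S = (\<Sum>U\<in>mats r A. ?S)"
    by simp
  also have "\<dots> = (\<Sum>U\<in>mats r A. \<Sum>X\<in>GL_Zmod r n. \<chi> (det X mod int n) * add_char m b (mat_trace (U * X)))"
    by (rule sum.cong[OF refl eq])
  also have "\<dots> = (\<Sum>X\<in>GL_Zmod r n. \<chi> (det X mod int n) * (\<Sum>U\<in>mats r A. add_char m b (mat_trace (U * X))))"
    unfolding sum_distrib_left by (rule sum.swap)
  also have "\<dots> = (\<Sum>X\<in>GL_Zmod r n. of_nat (card (mats r A)) *
      (if upper_triangular_mod r m X then \<chi> (det X mod int n) * add_char m b (mat_trace X) else 0))"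
  proof (rule sum.cong)
    fix X assume "X \<in> GL_Zmod r n"
    then show "\<chi> (det X mod int n) * (\<Sum>U\<in>mats r A. add_char m b (mat_trace (U * X))) =
        of_nat (card (mats r A)) *
        (if upper_triangular_mod r m X then \<chi> (det X mod int n) * add_char m b (mat_trace X) else 0)"
      using sum_unipotent_add_char[OF n m GL_Zmod_carrier, of X r] by (simp add: A_def)
  qed simp
  also have "\<dots> = of_nat (card (mats r A)) * ?T"
    using n by (simp add: sum.inter_filter sum_distrib_left)
  finally have "of_nat (card (mats r A)) * ?S = of_nat (card (mats r A)) * ?T" .
  moreover have "card (A i j) \<noteq> 0" for i j
    using n by (auto simp: A_def Zmod_def)
  then have "card (mats r A) \<noteq> 0"
    unfolding card_mats[OF fin] by (simp add: prod_zero_iff)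
  ultimately show ?thesis
    by simp
qed

section \<open>Multiplicativity of the induced character\<close>

lemma induced_char_one:
  assumes "n > 0" "mult_character n \<chi>" "m dvd n" "conductor n \<chi> dvd m"
  shows "induced_char n m \<chi> (1 mod int m) = 1"
  using induced_char_mod[OF assms, of 1] mult_character_one[OF assms(1,2)] by simp

text \<open>Units mod m lift to units mod n, and a product of lifts is a lift of the product, so the
  property passes down from \<chi>.\<close>

lemma induced_char_mult:
  assumes "n > 0" "mult_character n \<chi>" "m dvd n" "conductor n \<chi> dvd m"
    "coprime x (int m)" "coprime y (int m)"
  shows "induced_char n m \<chi> (x * y mod int m) =
    induced_char n m \<chi> (x mod int m) * induced_char n m \<chi> (y mod int m)"
proof -
  note ind = induced_char_mod[OF assms(1-4)]
  obtain x' where x': "coprime x' (int n)" "[x' = x] (mod int m)"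
    using unit_lift[OF assms(1,3,5)] by blast
  obtain y' where y': "coprime y' (int n)" "[y' = y] (mod int m)"
    using unit_lift[OF assms(1,3,6)] by blast
  have "x * y mod int m = x' * y' mod int m"
    using cong_mult[OF x'(2) y'(2)] by (simp add: cong_def)
  moreover have "x mod int m = x' mod int m" "y mod int m = y' mod int m"
    using x' y' by (simp_all add: cong_def)
  ultimately show ?thesis
    using x' y' ind[of "x' * y'"] ind[of x'] ind[of y'] mult_character_mult[OF assms(1,2), of x' y']
    by simp
qed

lemma induced_char_prod:
  assumes "n > 0" "mult_character n \<chi>" "m dvd n" "conductor n \<chi> dvd m"
    "finite I" "\<And>i. i \<in> I \<Longrightarrow> coprime (y i) (int m)"
  shows "induced_char n m \<chi> ((\<Prod>i\<in>I. y i) mod int m) = (\<Prod>i\<in>I. induced_char n m \<chi> (y i mod int m))"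
  using assms(5,6)
proof (induction I rule: finite_induct)
  case empty
  then show ?case
    using induced_char_one[OF assms(1-4)] by simp
next
  case (insert i I)
  have "coprime (\<Prod>i\<in>I. y i) (int m)"
    using insert.prems by (intro prod_coprime_left) auto
  then show ?case
    using insert induced_char_mult[OF assms(1-4), of "y i" "\<Prod>i\<in>I. y i"] by simp
qed

section \<open>Triangular residues and evaluation of the sum\<close>

text \<open>The standard Borel subgroup of GL_r(Z_m) in least residues, written as a product set
  over the positions so that sums over it factor.\<close>

definition borel_mod :: "nat \<Rightarrow> nat \<Rightarrow> int mat set" where
  "borel_mod r m = mats r (\<lambda>i j. if i = j then Zmod_units m else if i < j then Zmod m else {0})"

lemma borel_mod_entry:
  assumes "Y \<in> borel_mod r m" "i < r" "j < r"
  shows "Y $$ (i, j) \<in> (if i = j then Zmod_units m else if i < j then Zmod m else {0})"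
  using assms unfolding borel_mod_def mats_def by blast

lemma borel_mod_carrier: "Y \<in> borel_mod r m \<Longrightarrow> Y \<in> carrier_mat r r"
  by (simp add: borel_mod_def mats_def)

lemma det_borel_mod:
  assumes "Y \<in> borel_mod r m"
  shows "det Y = (\<Prod>i<r. Y $$ (i, i))"
proof -
  note Y = borel_mod_carrier[OF assms] and YA = borel_mod_entry[OF assms]
  have "Y $$ (i, j) = 0" if "i < r" "j < i" for i j
    using YA[of i j] that by simp
  then have "det Y = prod_list (diag_mat Y)"
    using Y by (intro det_upper_triangular[of _ r]) auto
  then show ?thesis
    using Y by (simp add: prod_list_diag_prod atLeast0LessThan)
qed

lemma borel_mod_diag:
  assumes "Y \<in> borel_mod r m" "i < r"
  shows "Y $$ (i, i) \<in> Zmod_units m"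
  using borel_mod_entry[OF assms assms(2)] by simp

lemma borel_mod_subset_GL:
  assumes "m > 0" "Y \<in> borel_mod r m"
  shows "Y \<in> GL_Zmod r m"
proof -
  note Y = borel_mod_carrier[OF assms(2)] and YA = borel_mod_entry[OF assms(2)]
  have "Y $$ (i, j) \<in> Zmod m" if "i < r" "j < r" for i j
    using YA[OF that] assms(1) by (auto simp: Zmod_units_def Zmod_def split: if_splits)
  then have "Y \<in> mats_mod r m"
    using Y by (simp add: mats_def)
  moreover have "coprime (det Y) (int m)"
    unfolding det_borel_mod[OF assms(2)]
    using borel_mod_diag[OF assms(2)] assms(1) by (intro prod_coprime_left) (simp add: Zmod_units_iff)
  ultimately show ?thesis
    using assms(1) by (simp add: GL_Zmod_eq)
qed

text \<open>For triangular residues the determinant is the product of the diagonal. It is a unit mod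
  m, hence so is each diagonal entry as a divisor of it.\<close>

lemma mat_mod_in_borel_iff:
  assumes "n > 0" "m > 0" "m dvd n" "X \<in> GL_Zmod r n"
  shows "mat_mod m X \<in> borel_mod r m \<longleftrightarrow> upper_triangular_mod r m X"
proof -
  have X: "X \<in> carrier_mat r r" and Xd: "coprime (det X) (int n)"
    using assms by (auto simp: GL_Zmod_eq mats_def)
  have idx: "mat_mod m X $$ (i, j) = X $$ (i, j) mod int m" if "i < r" "j < r" for i j
    using mat_mod_index[OF X that] .
  show ?thesis
  proof
    assume *: "mat_mod m X \<in> borel_mod r m"
    have "X $$ (j, i) mod int m = 0" if "i < r" "j < r" "i < j" for i j
    proof -
      have "mat_mod m X $$ (j, i) = 0"
        using borel_mod_entry[OF * that(2,1)] that(3) by simp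
      then show ?thesis
        using idx that by simp
    qed
    then show "upper_triangular_mod r m X"
      by (auto simp: upper_triangular_mod_def mod_eq_0_iff_dvd)
  next
    assume up: "upper_triangular_mod r m X"
    have zero: "mat_mod m X $$ (i, j) = 0" if "i < r" "j < i" for i j
      using up that idx[of i j] by (simp add: upper_triangular_mod_def)
    have "coprime (det (mat_mod m X)) (int m)"
      using cong_imp_coprime[OF cong_sym[OF det_mat_mod[OF X]]] coprime_dvd_trans[OF Xd assms(3)] by simp
    moreover have "det (mat_mod m X) = prod_list (diag_mat (mat_mod m X))"
      using X zero by (intro det_upper_triangular[of _ r]) (auto simp: mat_mod_def)
    moreover have "dim_row (mat_mod m X) = r"
      using X by (simp add: mat_mod_def)
    ultimately have co: "coprime (\<Prod>i<r. mat_mod m X $$ (i, i)) (int m)"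
      by (simp add: prod_list_diag_prod atLeast0LessThan)
    have diag: "mat_mod m X $$ (i, i) \<in> Zmod_units m" if "i < r" for i
    proof -
      have "mat_mod m X $$ (i, i) dvd (\<Prod>i<r. mat_mod m X $$ (i, i))"
        using that by (intro dvd_prodI) auto
      then have "coprime (mat_mod m X $$ (i, i)) (int m)"
        using co by (rule coprime_divisors[OF _ dvd_refl])
      then show ?thesis
        using assms(2) that idx by (simp add: Zmod_units_iff)
    qed
    have "mat_mod m X $$ (i, j) \<in> (if i = j then Zmod_units m else if i < j then Zmod m else {0})"
      if "i < r" "j < r" for i j
    proof (cases i j rule: linorder_cases)
      case less
      then show ?thesis
        using assms(2) by (simp add: idx[OF that])
    next
      case equal
      then show ?thesis
        using diag that by simp
    next
      case greater
      then show ?thesis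
        using zero that by simp
    qed
    then show "mat_mod m X \<in> borel_mod r m"
      using X by (simp add: borel_mod_def mats_def)
  qed
qed

text \<open>The exponent of c is the number of positions strictly above the diagonal.\<close>

lemma prod_triangular:
  "(\<Prod>i<r. \<Prod>j<r. if i = j then G else if i < j then c else (1 :: 'a :: comm_semiring_1)) =
    c ^ (r * (r - 1) div 2) * G ^ r"
proof (induction r)
  case (Suc r)
  have e: "Suc r * (Suc r - 1) div 2 = r * (r - 1) div 2 + r"
  proof -
    have "Suc r * (Suc r - 1) = r * (r - 1) + 2 * r"
      by (cases r) auto
    then show ?thesis by simp
  qed
  \<comment> \<open>The new column lies to the right of the diagonal in each of the r old rows,
    which gives r further factors c. The new row adds only its diagonal factor G.\<close>
  have row: "(\<Prod>j<Suc r. if i = j then G else if i < j then c else 1) =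
      (\<Prod>j<r. if i = j then G else if i < j then c else 1) * c" if "i \<in> {..<r}" for i
    using that by simp
  have last: "(\<Prod>j<Suc r. if r = j then G else if r < j then c else 1) = G"
    by (simp add: prod.neutral)
  have "(\<Prod>i<Suc r. \<Prod>j<Suc r. if i = j then G else if i < j then c else 1) =
      (\<Prod>i<r. \<Prod>j<Suc r. if i = j then G else if i < j then c else 1) *
      (\<Prod>j<Suc r. if r = j then G else if r < j then c else 1)"
    by (rule prod.lessThan_Suc)
  also note last
  also have "(\<Prod>i<r. \<Prod>j<Suc r. if i = j then G else if i < j then c else 1) =
      (\<Prod>i<r. (\<Prod>j<r. if i = j then G else if i < j then c else 1) * c)"
    by (rule prod.cong[OF refl row])
  also have "\<dots> = (c ^ (r * (r - 1) div 2) * G ^ r) * c ^ r"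
    by (simp add: prod.distrib Suc.IH)
  finally show ?case
    unfolding e by (simp add: power_add mult_ac)
qed simp

text \<open>Determinant and trace of a triangular residue involve only its diagonal, so the summand
  is a product over positions: each diagonal position yields a Gauss sum, each position above it a
  factor m.\<close>

lemma GL_sum_eq_gauss_sum_power:
  assumes n: "n > 0" and m: "m > 0" "m dvd n" "coprime b (int m)" and \<chi>: "mult_character n \<chi>"
    and f: "conductor n \<chi> dvd m"
  shows "(\<Sum>X\<in>GL_Zmod r n. \<chi> (det X mod int n) * add_char m b (mat_trace X)) =
    of_nat (n div m) ^ (r * r) *
      (\<Prod>p\<in>{p. prime p \<and> p dvd n \<and> \<not> p dvd m}. \<Prod>i = 1..r. 1 - 1 / of_nat p ^ i) *
      (of_nat m ^ (r * (r - 1) div 2) * gauss_sum m (induced_char n m \<chi>) (add_char m b) ^ r)"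
proof -
  let ?F = "\<lambda>X. \<chi> (det X mod int n) * add_char m b (mat_trace X)"
  let ?\<psi> = "induced_char n m \<chi>"
  let ?C = "of_nat (n div m) ^ (r * r) *
      (\<Prod>p\<in>{p. prime p \<and> p dvd n \<and> \<not> p dvd m}. \<Prod>i = 1..r. 1 - 1 / of_nat p ^ i) :: complex"
  let ?A = "\<lambda>i j. if i = j then Zmod_units m else if i < j then Zmod m else {0}"
  \<comment> \<open>The diagonal factors are padded with 1 off the diagonal, to fit the form
    required by \<open>sum_prod_mats\<close>.\<close>
  define h where "h = (\<lambda>(i :: nat) j x. if i = j then ?\<psi> x * add_char m b x else 1)"
  let ?S = "{X \<in> GL_Zmod r n. upper_triangular_mod r m X}"
  have finU: "finite (Zmod_units m)"
    by (rule finite_subset[of _ "Zmod m"]) (auto simp: Zmod_units_def)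
  have finA: "finite (?A i j)" for i j
    using finU by simp
  have finB: "finite (borel_mod r m)"
    unfolding borel_mod_def by (rule finite_mats) (rule finA)
  have finS: "finite ?S"
    using n by simp
  have img: "mat_mod m ` ?S \<subseteq> borel_mod r m"
    using mat_mod_in_borel_iff[OF n m(1,2)] by auto
  have F: "?F X = (\<Prod>i<r. \<Prod>j<r. h i j (Y $$ (i, j)))"
    if X: "X \<in> GL_Zmod r n" and Y: "Y \<in> borel_mod r m" and XY: "mat_mod m X = Y" for X Y
  proof -
    have Xc: "X \<in> carrier_mat r r" and Xd: "coprime (det X) (int n)"
      using X n by (auto simp: GL_Zmod_eq mats_def)
    have Yc: "Y \<in> carrier_mat r r"
      using XY Xc by auto
    have unit: "coprime (Y $$ (i, i)) (int m)" "Y $$ (i, i) mod int m = Y $$ (i, i)" if "i < r" for i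
      using borel_mod_diag[OF Y that] m(1) by (simp_all add: Zmod_units_iff)
    have "det X mod int m = det Y mod int m"
      using det_mat_mod[OF Xc, of m] XY by (simp add: cong_def)
    then have "\<chi> (det X mod int n) = ?\<psi> ((\<Prod>i<r. Y $$ (i, i)) mod int m)"
      using induced_char_mod[OF n \<chi> m(2) f Xd] det_borel_mod[OF Y] by simp
    also have "\<dots> = (\<Prod>i<r. ?\<psi> (Y $$ (i, i) mod int m))"
      by (rule induced_char_prod[OF n \<chi> m(2) f]) (auto simp: unit)
    also have "\<dots> = (\<Prod>i<r. ?\<psi> (Y $$ (i, i)))"
      by (intro prod.cong) (auto simp: unit)
    finally have 1: "\<chi> (det X mod int n) = (\<Prod>i<r. ?\<psi> (Y $$ (i, i)))" .
    have "add_char m b (mat_trace X) = add_char m b (mat_trace Y)"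
      using add_char_cong[OF m(1) mat_trace_mat_mod[OF Xc]] XY by metis
    then have 2: "add_char m b (mat_trace X) = (\<Prod>i<r. add_char m b (Y $$ (i, i)))"
      using Yc by (simp add: mat_trace_def add_char_sum)
    have "(\<Prod>i<r. \<Prod>j<r. h i j (Y $$ (i, j))) = (\<Prod>i<r. ?\<psi> (Y $$ (i, i)) * add_char m b (Y $$ (i, i)))"
      by (rule prod_diagonal) (simp_all add: h_def)
    then show ?thesis
      unfolding 1 2 by (simp add: prod.distrib)
  qed
  have "(\<Sum>X\<in>GL_Zmod r n. ?F X) = (\<Sum>X\<in>?S. ?F X)"
    by (rule GL_sum_upper_triangular[OF n m \<chi>])
  also have "\<dots> = (\<Sum>Y\<in>borel_mod r m. \<Sum>X\<in>{X \<in> ?S. mat_mod m X = Y}. ?F X)"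
    by (rule sum.group[OF finS finB img, symmetric])
  also have "\<dots> = (\<Sum>Y\<in>borel_mod r m. ?C * (\<Prod>i<r. \<Prod>j<r. h i j (Y $$ (i, j))))"
  proof (rule sum.cong)
    fix Y assume Y: "Y \<in> borel_mod r m"
    \<comment> \<open>Every invertible lift of a triangular residue is triangular mod m, so the
      fibre inside \<open>?S\<close> is the full fibre already counted.\<close>
    have eq: "{X \<in> ?S. mat_mod m X = Y} = {X \<in> GL_Zmod r n. mat_mod m X = Y}"
      using mat_mod_in_borel_iff[OF n m(1,2)] Y by auto
    have "(\<Sum>X\<in>{X \<in> ?S. mat_mod m X = Y}. ?F X) =
        (\<Sum>X\<in>{X \<in> GL_Zmod r n. mat_mod m X = Y}. \<Prod>i<r. \<Prod>j<r. h i j (Y $$ (i, j)))"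
      unfolding eq by (rule sum.cong[OF refl], rule F[OF _ Y]) simp_all
    also have "\<dots> = of_nat (card {X \<in> GL_Zmod r n. mat_mod m X = Y}) * (\<Prod>i<r. \<Prod>j<r. h i j (Y $$ (i, j)))"
      by simp
    also have "of_nat (card {X \<in> GL_Zmod r n. mat_mod m X = Y}) = ?C"
      by (rule card_GL_fibre[OF n m(2) borel_mod_subset_GL[OF m(1) Y]])
    finally show "(\<Sum>X\<in>{X \<in> ?S. mat_mod m X = Y}. ?F X) = ?C * (\<Prod>i<r. \<Prod>j<r. h i j (Y $$ (i, j)))" .
  qed simp
  also have "\<dots> = ?C * (\<Sum>Y\<in>mats r ?A. \<Prod>i<r. \<Prod>j<r. h i j (Y $$ (i, j)))"
    unfolding borel_mod_def sum_distrib_left ..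
  also have "(\<Sum>Y\<in>mats r ?A. \<Prod>i<r. \<Prod>j<r. h i j (Y $$ (i, j))) = (\<Prod>i<r. \<Prod>j<r. \<Sum>x\<in>?A i j. h i j x)"
    by (rule sum_prod_mats) (rule finA)
  also have "\<dots> = (\<Prod>i<r. \<Prod>j<r. if i = j then gauss_sum m ?\<psi> (add_char m b) else if i < j then of_nat m else 1)"
    by (intro prod.cong refl) (simp add: h_def gauss_sum_def)
  also have "\<dots> = of_nat m ^ (r * (r - 1) div 2) * gauss_sum m ?\<psi> (add_char m b) ^ r"
    by (rule prod_triangular)
  finally show ?thesis .
qed

theorem theorem2:
  fixes n r d f :: nat and a :: int and \<chi> \<mu> :: "int \<Rightarrow> complex"
  assumes "n \<ge> 1" and "r \<ge> 1"
    and "mult_character n \<chi>"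
    and "f = conductor n \<chi>"
    and "\<mu> = add_char n a"
    and "d = nat (gcd a (int n))"
  shows "(f dvd n div d \<longrightarrow>
            GL_gauss_sum r n \<chi> \<mu> =
              of_nat n ^ (r * (r - 1) div 2) * of_nat d ^ (r * (r + 1) div 2) *
              (\<Prod>p \<in> {p. prime p \<and> p dvd n \<and> \<not> p dvd n div d}.
                 \<Prod>i = 1..r. 1 - 1 / of_nat p ^ i) *
              gauss_sum (n div d) (induced_char n (n div d) \<chi>)
                (add_char (n div d) (a div int d)) ^ r)
       \<and> (\<not> f dvd n div d \<longrightarrow> GL_gauss_sum r n \<chi> \<mu> = 0)"
proof -
  define m where "m = n div d"
  define b where "b = a div int d"
  have n: "n > 0"
    using assms(1) by simp
  have gd: "int d = gcd a (int n)"
    using assms(6) by simp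
  have d: "d > 0"
    using gd n by (metis gcd_pos_int of_nat_0_less_iff less_irrefl)
  have "int d dvd int n" "int d dvd a"
    unfolding gd by simp_all
  then have dn: "n = d * m" and a: "a = int d * b"
    by (auto simp: m_def b_def)
  have m: "m > 0" "m dvd n"
    using n dn by auto
  have "coprime (a div int d) (int n div int d)"
    unfolding gd using n by (intro div_gcd_coprime) auto
  then have b: "coprime b (int m)"
    by (simp add: b_def m_def zdiv_int)
  have nd: "n div m = d"
    using m(1) dn by simp
  have \<mu>: "\<mu> = add_char m b"
    unfolding assms(5) a by (subst dn) (rule add_char_cancel[OF d])
  have sum: "GL_gauss_sum r n \<chi> \<mu> = (\<Sum>X\<in>GL_Zmod r n. \<chi> (det X mod int n) * add_char m b (mat_trace X))"
    unfolding GL_gauss_sum_def \<mu> by (simp add: add_char_mod[OF m])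
  show ?thesis
    unfolding m_def[symmetric] b_def[symmetric]
  proof (intro conjI impI)
    assume f: "f dvd m"
    have e: "r * r = r * (r - 1) div 2 + r * (r + 1) div 2"
    proof -
      have "even (r * (r - 1))" "even (r * (r + 1))"
        by auto
      then have "2 * (r * (r - 1) div 2 + r * (r + 1) div 2) = r * (r - 1) + r * (r + 1)"
        by simp
      also have "\<dots> = 2 * (r * r)"
        by (cases r) auto
      finally show ?thesis by simp
    qed
    \<comment> \<open>With n = d m, the exponents r(r-1)/2 and r(r+1)/2 of d add up to r^2, the
      number of entries that are lifted from Z_m to Z_n.\<close>
    have pw: "of_nat n ^ (r * (r - 1) div 2) * of_nat d ^ (r * (r + 1) div 2) =
        (of_nat d ^ (r * r) * of_nat m ^ (r * (r - 1) div 2) :: complex)"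
      unfolding e by (simp add: dn power_add power_mult_distrib mult_ac)
    show "GL_gauss_sum r n \<chi> \<mu> =
        of_nat n ^ (r * (r - 1) div 2) * of_nat d ^ (r * (r + 1) div 2) *
        (\<Prod>p \<in> {p. prime p \<and> p dvd n \<and> \<not> p dvd m}. \<Prod>i = 1..r. 1 - 1 / of_nat p ^ i) *
        gauss_sum m (induced_char n m \<chi>) (add_char m b) ^ r"
      unfolding sum pw using GL_sum_eq_gauss_sum_power[OF n m b assms(3), of r] f assms(4) nd
      by (simp add: mult_ac)
  next
    assume "\<not> f dvd m"
    then have "\<not> factors_through n \<chi> m"
      using conductor_dvd[OF n assms(3)] assms(4) by blast
    then show "GL_gauss_sum r n \<chi> \<mu> = 0"
      unfolding sum using GL_sum_eq_0[OF n m assms(3)] assms(2) by simp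
  qed
qed

end
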